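(* Let $\rho^{(0)}\in\mathcal M_{++}$, and define the AB iterates $\rho_{AB}^{(0)}=\rho^{(0)}$, $\rho_{AB}^{(t+1)}=\mathcal T_{AB}(\rho_{AB}^{(t)})$ and the MD iterates $\rho_{MD}^{(0)}=\rho^{(0)}$, $\rho_{MD}^{(t+1)}=\mathcal T_{MD}(\rho_{MD}^{(t)})$. For every integer $T\ge1$, the two sequences agree through step $T$ (i.e. $\rho_{AB}^{(t)}=\rho_{MD}^{(t)}$ for $t=0,\dots,T$) if and only if, along the common iterates $\rho^{(t)}=\rho_{AB}^{(t)}$, $$\Omega(\rho^{(t)})-\nabla f(\rho^{(t)})\in N_{\mathcal M},\qquad t=0,\dots,T-1.$$ In particular, $\mathcal T_{AB}=\mathcal T_{MD}$ on $\mathcal M_{++}$ if and only if $\Omega(\rho)-\nabla f(\rho)\in N_{\mathcal M}$ for every $\rho\in\mathcal M_{++}$.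
   Context: $\mathcal H$ is a finite-dimensional complex Hilbert space, $\mathcal B(\mathcal H)$ the real space of Hermitian operators with inner product $\langle X,Y\rangle=\operatorname{Tr}(XY)$, $\mathcal S(\mathcal H)$ the set of density operators. $H_1,\dots,H_k\in\mathcal B(\mathcal H)$ and $c\in\mathbb R^k$ are given, with $\{I,H_1,\dots,H_k\}$ linearly independent, and $\mathcal M=\{\rho\in\mathcal S(\mathcal H):\operatorname{Tr}(\rho H_j)=c_j,\ j=1,\dots,k\}$ is assumed to contain a positive-definite state; $\mathcal M_{++}=\{\rho\in\mathcal M:\rho\succ0\}$. $T_{\mathcal M}=\{X\in\mathcal B(\mathcal H):\operatorname{Tr}X=0,\ \operatorname{Tr}(XH_j)=0\ \forall j\}$ and $N_{\mathcal M}=T_{\mathcal M}^\perp=\operatorname{span}\{I,H_1,\dots,H_k\}$. $\Omega:\mathcal S(\mathcal H)\to\mathcal B(\mathcal H)$ is continuous, $f(\rho)=\operatorname{Tr}[\rho\,\Omega(\rho)]$, and $\gamma>0$. $f$ is assumed differentiable relative to the affine hull of $\mathcal M$: $\nabla f(\rho)\in\mathcal B(\mathcal H)$ denotes an operator with $f(\sigma)=f(\rho)+\operatorname{Tr}[\nabla f(\rho)(\sigma-\rho)]+o(\|\sigma-\rho\|)$ as $\sigma\to\rho$ in $\mathcal M$ (determined up to adding elements of $N_{\mathcal M}$). $D(\sigma\|\rho)=\operatorname{Tr}\,\sigma(\log\sigma-\log\rho)$ (with $0\log0=0$). For $\rho\in\mathcal M_{++}$ the Arimoto–Blahut (AB)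 map is $\mathcal T_{AB}(\rho)=\arg\min_{\sigma\in\mathcal M}D(\sigma\|\mathcal F_3[\rho])$, where $\mathcal F_3[\rho]=\exp(\log\rho-\tfrac1\gamma\Omega(\rho))/\operatorname{Tr}\exp(\log\rho-\tfrac1\gamma\Omega(\rho))$, and the mirror-descent (MD) map is $\mathcal T_{MD}(\rho)=\arg\min_{\sigma\in\mathcal M}\{\operatorname{Tr}[\sigma\nabla f(\rho)]+\gamma D(\sigma\|\rho)\}$. Both maps send $\mathcal M_{++}$ into $\mathcal M_{++}$. *)

theory Defs
  imports "HOL-Analysis.Analysis"
begin

text \<open>
  The Hilbert space is \<open>complex^'n\<close>; operators on it are the matrices \<open>complex^'n^'n\<close>, whose library
  norm is the Hilbert--Schmidt norm. The real inner product \<open>x \<bullet> y\<close> of \<open>complex^'n\<close>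
  is the real part of the Hermitian one.
\<close>

definition adj :: "complex^'n^'n \<Rightarrow> complex^'n^'n" where
  "adj A = (\<chi> i j. cnj (A $ j $ i))"

definition herm :: "(complex^'n^'n) set" where
  "herm = {A. adj A = A}"

definition pos_semidef :: "complex^'n^'n \<Rightarrow> bool" where
  "pos_semidef A \<longleftrightarrow> A \<in> herm \<and> (\<forall>x. 0 \<le> x \<bullet> (A *v x))"

definition pos_def :: "complex^'n^'n \<Rightarrow> bool" where
  "pos_def A \<longleftrightarrow> A \<in> herm \<and> (\<forall>x. x \<noteq> 0 \<longrightarrow> 0 < x \<bullet> (A *v x))"

definition density_ops :: "(complex^'n^'n) set" where
  "density_ops = {A. pos_semidef A \<and> trace A = 1}"

text \<open>For Hermitian arguments \<open>trace (X ** Y)\<close> is real, so \<open>Re\<close> only changes the type.\<close>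

definition hs_inner :: "complex^'n^'n \<Rightarrow> complex^'n^'n \<Rightarrow> real" where
  "hs_inner X Y = Re (trace (X ** Y))"

definition unitary_op :: "complex^'n^'n \<Rightarrow> bool" where
  "unitary_op U \<longleftrightarrow> U ** adj U = mat 1 \<and> adj U ** U = mat 1"

definition diag_op :: "('n \<Rightarrow> real) \<Rightarrow> complex^'n^'n" where
  "diag_op d = (\<chi> i j. if i = j then of_real (d i) else 0)"

text \<open>
  Spectral functional calculus, meant for Hermitian \<open>A\<close>. The value does not depend on the chosen
  diagonalisation: see \<open>fun_calc_diag\<close> below.
\<close>

definition fun_calc :: "(real \<Rightarrow> real) \<Rightarrow> complex^'n^'n \<Rightarrow> complex^'n^'n" where
  "fun_calc f A = (THE B. \<exists>U d. unitary_op U \<and> A = U ** diag_op d ** adj U \<and>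
                               B = U ** diag_op (\<lambda>i. f (d i)) ** adj U)"

lemma diag_op_mult_left: "(diag_op d ** A) $ i $ j = of_real (d i) * A $ i $ j"
  by (simp add: diag_op_def matrix_matrix_mult_def if_distrib if_distribR cong: if_cong)

lemma diag_op_mult_right: "(A ** diag_op d) $ i $ j = A $ i $ j * of_real (d j)"
  by (simp add: diag_op_def matrix_matrix_mult_def if_distrib if_distribR cong: if_cong)

lemma fun_calc_unique:
  assumes U: "unitary_op U" and V: "unitary_op V"
    and eq: "U ** diag_op d ** adj U = V ** diag_op e ** adj V"
  shows "U ** diag_op (\<lambda>i. f (d i)) ** adj U = V ** diag_op (\<lambda>i. f (e i)) ** adj V"
proof -
  define W where "W = adj V ** U"
  have VW: "V ** W = U"
    unfolding W_def by (metis V unitary_op_def matrix_mul_assoc matrix_mul_lid)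
  have WU: "W ** adj U = adj V"
    unfolding W_def by (metis U unitary_op_def matrix_mul_assoc matrix_mul_rid)
  have "W ** diag_op d = adj V ** (U ** diag_op d ** adj U) ** U"
    unfolding W_def by (metis U unitary_op_def matrix_mul_assoc matrix_mul_rid)
  also have "\<dots> = diag_op e ** W"
    unfolding W_def eq by (metis V unitary_op_def matrix_mul_assoc matrix_mul_lid)
  finally have 1: "W ** diag_op d = diag_op e ** W" .
  have "W $ i $ j * of_real (f (d j)) = of_real (f (e i)) * W $ i $ j" for i j
  proof -
    have "W $ i $ j * of_real (d j) = of_real (e i) * W $ i $ j"
      using 1 by (metis diag_op_mult_left diag_op_mult_right)
    then show ?thesis
      by (cases "W $ i $ j = 0") auto
  qed
  then have 2: "W ** diag_op (\<lambda>i. f (d i)) = diag_op (\<lambda>i. f (e i)) ** W"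
    by (simp add: vec_eq_iff diag_op_mult_left diag_op_mult_right)
  have "U ** diag_op (\<lambda>i. f (d i)) ** adj U = V ** (W ** diag_op (\<lambda>i. f (d i))) ** adj U"
    using VW by (metis matrix_mul_assoc)
  also have "\<dots> = V ** diag_op (\<lambda>i. f (e i)) ** (W ** adj U)"
    unfolding 2 by (metis matrix_mul_assoc)
  finally show ?thesis
    unfolding WU .
qed

lemma fun_calc_diag:
  assumes "unitary_op U"
  shows "fun_calc f (U ** diag_op d ** adj U) = U ** diag_op (\<lambda>i. f (d i)) ** adj U"
  unfolding fun_calc_def
  using assms by (intro the_equality) (blast intro: fun_calc_unique[symmetric] | metis fun_calc_unique)+

definition op_exp :: "complex^'n^'n \<Rightarrow> complex^'n^'n" where
  "op_exp = fun_calc exp"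

definition op_log :: "complex^'n^'n \<Rightarrow> complex^'n^'n" where
  "op_log = fun_calc ln"

text \<open>
  Used for \<open>\<sigma>\<close> a density operator and \<open>\<rho>\<close> positive definite, where no value \<open>\<infinity>\<close> occurs. On the kernel
  of \<open>\<sigma>\<close> the factor \<open>\<sigma>\<close> annihilates whatever \<open>op_log \<sigma>\<close> is there, which is the convention \<open>0 log 0 = 0\<close>.
\<close>

definition rel_entropy :: "complex^'n^'n \<Rightarrow> complex^'n^'n \<Rightarrow> real" where
  "rel_entropy \<sigma> \<rho> = Re (trace (\<sigma> ** (op_log \<sigma> - op_log \<rho>)))"

definition feasible_set :: "nat \<Rightarrow> (nat \<Rightarrow> complex^'n^'n) \<Rightarrow> (nat \<Rightarrow> real) \<Rightarrow> (complex^'n^'n) set" where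
  "feasible_set k H c = {\<rho> \<in> density_ops. \<forall>j\<in>{1..k}. hs_inner \<rho> (H j) = c j}"

definition feasible_pd :: "nat \<Rightarrow> (nat \<Rightarrow> complex^'n^'n) \<Rightarrow> (nat \<Rightarrow> real) \<Rightarrow> (complex^'n^'n) set" where
  "feasible_pd k H c = {\<rho> \<in> feasible_set k H c. pos_def \<rho>}"

text \<open>
  Linear independence of the family \<open>I, H 1, \<dots>, H k\<close> over the reals; \<open>inj_on\<close> and the non-membership
  exclude repetitions, which the set of its members would not see.
\<close>

definition id_constraints_independent :: "nat \<Rightarrow> (nat \<Rightarrow> complex^'n^'n) \<Rightarrow> bool" where
  "id_constraints_independent k H \<longleftrightarrow>
     inj_on H {1..k} \<and> mat 1 \<notin> H ` {1..k} \<and> independent (insert (mat 1) (H ` {1..k}))"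

definition constraint_tangents :: "nat \<Rightarrow> (nat \<Rightarrow> complex^'n^'n) \<Rightarrow> (complex^'n^'n) set" where
  "constraint_tangents k H = {X \<in> herm. trace X = 0 \<and> (\<forall>j\<in>{1..k}. hs_inner X (H j) = 0)}"

definition constraint_normals :: "nat \<Rightarrow> (nat \<Rightarrow> complex^'n^'n) \<Rightarrow> (complex^'n^'n) set" where
  "constraint_normals k H = {Y \<in> herm. \<forall>X\<in>constraint_tangents k H. hs_inner X Y = 0}"

definition objective :: "(complex^'n^'n \<Rightarrow> complex^'n^'n) \<Rightarrow> complex^'n^'n \<Rightarrow> real" where
  "objective \<Omega> \<rho> = hs_inner \<rho> (\<Omega> \<rho>)"

definition gibbs_update ::
    "(complex^'n^'n \<Rightarrow> complex^'n^'n) \<Rightarrow> real \<Rightarrow> complex^'n^'n \<Rightarrow> complex^'n^'n" where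
  "gibbs_update \<Omega> \<gamma> \<rho> =
     (let E = op_exp (op_log \<rho> - (1 / \<gamma>) *\<^sub>R \<Omega> \<rho>) in (1 / Re (trace E)) *\<^sub>R E)"

definition ab_map ::
    "(complex^'n^'n) set \<Rightarrow> (complex^'n^'n \<Rightarrow> complex^'n^'n) \<Rightarrow> real \<Rightarrow> complex^'n^'n \<Rightarrow> complex^'n^'n" where
  "ab_map M \<Omega> \<gamma> \<rho> = arg_min_on (\<lambda>\<sigma>. rel_entropy \<sigma> (gibbs_update \<Omega> \<gamma> \<rho>)) M"

text \<open>Here \<open>G\<close> is the gradient field of the objective.\<close>

definition md_map ::
    "(complex^'n^'n) set \<Rightarrow> (complex^'n^'n \<Rightarrow> complex^'n^'n) \<Rightarrow> real \<Rightarrow> complex^'n^'n \<Rightarrow> complex^'n^'n" where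
  "md_map M G \<gamma> \<rho> = arg_min_on (\<lambda>\<sigma>. hs_inner \<sigma> (G \<rho>) + \<gamma> * rel_entropy \<sigma> \<rho>) M"

text \<open>
  \<open>g\<close> is a gradient of \<open>f\<close> at \<open>\<rho>\<close> relative to \<open>M\<close>: by the definition of \<open>has_derivative\<close>,
  \<open>f \<sigma> = f \<rho> + hs_inner g (\<sigma> - \<rho>) + o(norm (\<sigma> - \<rho>))\<close> as \<open>\<sigma>\<close> tends to \<open>\<rho>\<close> inside \<open>M\<close>. Such a \<open>g\<close>
  is not unique.
\<close>

definition gradient_rel ::
    "(complex^'n^'n) set \<Rightarrow> (complex^'n^'n \<Rightarrow> real) \<Rightarrow> complex^'n^'n \<Rightarrow> complex^'n^'n \<Rightarrow> bool" where
  "gradient_rel M f \<rho> g \<longleftrightarrow> g \<in> herm \<and> (f has_derivative (\<lambda>X. hs_inner g X)) (at \<rho> within M)"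

end

theory Submission
  imports Defs "HOL-Real_Asymp.Real_Asymp"
begin

text \<open>
  Both updates minimise \<open>\<sigma> \<mapsto> Tr \<sigma> (log \<sigma> - A)\<close> over the feasible set, with \<open>A = log \<rho> - \<Omega> \<rho> / \<gamma>\<close> for
  Arimoto--Blahut and \<open>A = log \<rho> - \<nabla>f \<rho> / \<gamma>\<close> for mirror descent. If \<open>\<Omega> \<rho> - \<nabla>f \<rho>\<close> is normal to the
  constraints, the two objectives differ by a constant on the feasible set. Conversely, any minimiser
  \<open>\<sigma>\<close> is positive definite and stationary, i.e. \<open>log \<sigma> - A\<close> is normal; a common minimiser therefore
  forces the difference of the two operators \<open>A\<close> to be normal. Klein's inequality replaces the
  differentiability of the entropy: it bounds the increment of the objective from \<open>\<sigma>\<close> to \<open>\<tau>\<close> by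
  \<open>Tr (\<tau> - \<sigma>) (log \<tau> - A)\<close>, so only continuity of \<open>log\<close> is needed.
\<close>

subsection \<open>Spectral theorem\<close>

lemma adj_nth [simp]: "adj A $ i $ j = cnj (A $ j $ i)"
  by (simp add: adj_def)

lemma adj_adj [simp]: "adj (adj A) = A"
  by (simp add: vec_eq_iff)

lemma adj_mult: "adj (A ** B) = adj B ** adj A"
  by (simp add: vec_eq_iff matrix_matrix_mult_def mult.commute)

lemma adj_diag_op [simp]: "adj (diag_op d) = diag_op d"
  by (simp add: vec_eq_iff diag_op_def)

lemma subspace_herm: "subspace herm"
  by (simp add: subspace_def herm_def vec_eq_iff)

lemmas herm_add = subspace_add[OF subspace_herm]
  and herm_diff = subspace_diff[OF subspace_herm]
  and herm_scaleR = subspace_scale[OF subspace_herm]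

text \<open>Links the trace form to the library's real inner product, from which its bilinearity and
  continuity are inherited below.\<close>

lemma hs_inner_adj: "hs_inner X Y = adj X \<bullet> Y"
  by (simp add: hs_inner_def trace_def matrix_matrix_mult_def inner_vec_def inner_complex_def)
    (rule sum.swap)

lemma hs_inner_herm: "X \<in> herm \<Longrightarrow> hs_inner X Y = X \<bullet> Y"
  by (simp add: hs_inner_adj herm_def)

lemma hs_inner_commute: "hs_inner X Y = hs_inner Y X"
  unfolding hs_inner_def using trace_mul_sym[of X Y] by (rule arg_cong)

lemma inner_mult_cnj: "x \<bullet> (a * y) = (cnj a * x) \<bullet> (y :: complex)"
  by (simp add: inner_complex_def algebra_simps)

lemma inner_adj_mult_vec: "x \<bullet> (A *v y) = (adj A *v x) \<bullet> y"
proof -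
  have "x \<bullet> (A *v y) = (\<Sum>i\<in>UNIV. \<Sum>j\<in>UNIV. x $ i \<bullet> (A $ i $ j * y $ j))"
    by (simp add: inner_vec_def matrix_vector_mult_def inner_sum_right)
  also have "\<dots> = (\<Sum>j\<in>UNIV. \<Sum>i\<in>UNIV. x $ i \<bullet> (A $ i $ j * y $ j))"
    by (rule sum.swap)
  also have "\<dots> = (adj A *v x) \<bullet> y"
    by (simp only: inner_mult_cnj inner_vec_def matrix_vector_mult_def inner_sum_left adj_nth
        vec_lambda_beta)
  finally show ?thesis .
qed

lemma inner_unitary_mult_vec: "unitary_op U \<Longrightarrow> (U *v x) \<bullet> (U *v y) = x \<bullet> y"
  unfolding inner_adj_mult_vec[of "U *v x"] by (simp add: unitary_op_def matrix_vector_mul_assoc)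

lemma unitary_adj: "unitary_op U \<Longrightarrow> unitary_op (adj U)"
  by (simp add: unitary_op_def)

lemma norm_unitary_mult_vec: "unitary_op U \<Longrightarrow> norm (U *v x) = norm x"
  by (simp add: norm_eq_sqrt_inner inner_unitary_mult_vec)

lemma column_matrix_mult: "column i (A ** B) = A *v column i B"
  by (simp add: vec_eq_iff column_def matrix_matrix_mult_def matrix_vector_mult_def)

lemma unitary_norm_column:
  fixes U :: "complex^'n^'n"
  assumes "unitary_op U" shows "norm (column i U) = 1"
proof -
  have "norm (column i U) = norm (U *v column i (mat 1))"
    by (simp flip: column_matrix_mult)
  also have "column i (mat 1 :: complex^'n^'n) = axis i 1"
    by (auto simp: vec_eq_iff column_def mat_def axis_def)
  finally show ?thesis
    using norm_unitary_mult_vec[OF assms] by simp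
qed

lemma inner_diag_conj:
  "x \<bullet> ((U ** diag_op d ** adj U) *v x) = (\<Sum>j\<in>UNIV. d j * (norm ((adj U *v x) $ j))\<^sup>2)"
proof -
  have "x \<bullet> ((U ** diag_op d ** adj U) *v x) = (adj U *v x) \<bullet> (diag_op d *v (adj U *v x))"
    by (simp add: inner_adj_mult_vec[of x] matrix_vector_mul_assoc[symmetric])
  moreover have "diag_op d *v y = (\<chi> j. of_real (d j) * y $ j)" for y
    by (simp add: vec_eq_iff diag_op_def matrix_vector_mult_def if_distrib if_distribR cong: if_cong)
  ultimately show ?thesis
    by (simp add: inner_vec_def inner_complex_def cmod_def power2_eq_square algebra_simps)
qed

lemma herm_diag_conj: "U ** diag_op d ** adj U \<in> herm"
  by (simp add: herm_def adj_mult matrix_mul_assoc)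

text \<open>By cyclicity of the trace, only the diagonal of \<open>B\<close> in the eigenbasis of
  the first argument enters.\<close>

lemma hs_inner_diag_conj:
  "hs_inner (U ** diag_op d ** adj U) B = (\<Sum>i\<in>UNIV. d i * (column i U \<bullet> (B *v column i U)))"
proof -
  have "hs_inner (U ** diag_op d ** adj U) B = Re (trace (diag_op d ** (adj U ** (B ** U))))"
    unfolding hs_inner_def by (metis matrix_mul_assoc trace_mul_sym)
  also have "\<dots> = (\<Sum>i\<in>UNIV. d i * Re ((adj U ** (B ** U)) $ i $ i))"
    by (simp add: trace_def diag_op_mult_left)
  moreover have "Re ((adj U ** (B ** U)) $ i $ i) = column i U \<bullet> (B *v column i U)" for i
    unfolding column_matrix_mult[symmetric]
    by (simp add: matrix_matrix_mult_def[of "adj U"] inner_vec_def inner_complex_def column_def)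
  ultimately show ?thesis
    by simp
qed

lemma matrix_mult_add_scaleR:
  "A ** (B + C) = A ** B + A ** (C :: complex^'n^'n)"
  "(B + C) ** A = B ** A + C ** A"
  "A ** (r *\<^sub>R B) = r *\<^sub>R (A ** B)"
  "(r *\<^sub>R B) ** A = r *\<^sub>R (B ** A)"
  by (simp_all add: vec_eq_iff matrix_matrix_mult_def sum.distrib algebra_simps scaleR_sum_right)

lemma column_diag_conj:
  assumes "unitary_op U"
  shows "(U ** diag_op d ** adj U) *v column i U = d i *\<^sub>R column i U"
proof -
  have "(U ** diag_op d ** adj U) *v column i U = column i (U ** diag_op d)"
    by (metis assms column_matrix_mult matrix_mul_assoc matrix_mul_rid unitary_op_def)
  also have "\<dots> = d i *\<^sub>R column i U"
    by (simp add: vec_eq_iff column_def diag_op_mult_right) (simp add: scaleR_conv_of_real)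
  finally show ?thesis .
qed

section \<open>Existence of an orthonormal eigenbasis\<close>

lemma matrix_vector_mult_scaleR_right: "A *v (r *\<^sub>R x) = r *\<^sub>R (A *v (x :: complex^'n))"
  by (simp add: vec_eq_iff matrix_vector_mult_def scaleR_sum_right)

text \<open>Variational argument: \<open>x\<close> maximises the quadratic form on the unit sphere
  of \<open>S\<close>, with maximum \<open>l\<close>. The residual
  \<open>r = A *v x - l *\<^sub>R x\<close> lies in \<open>S\<close> and is orthogonal to
  \<open>x\<close>; if it were nonzero, moving \<open>x\<close> along \<open>r\<close> would
  increase the Rayleigh quotient to first order.\<close>

lemma hermitian_eigenvector:
  fixes A :: "complex^'n^'n"
  assumes A: "A \<in> herm" and S: "subspace S" "S \<noteq> {0}" "\<And>x. x \<in> S \<Longrightarrow> A *v x \<in> S"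
  obtains x l where "x \<in> S" "norm x = 1" "A *v x = (l::real) *\<^sub>R x"
proof -
  obtain z where z: "z \<in> S" "z \<noteq> 0"
    using S subspace_0 by blast
  let ?K = "S \<inter> sphere 0 1"
  have "z /\<^sub>R norm z \<in> ?K"
    using z S by (simp add: subspace_scale)
  then have "?K \<noteq> {}"
    by blast
  moreover have "compact ?K"
    using S(1) by (intro closed_Int_compact closed_subspace) auto
  moreover have "continuous_on ?K (\<lambda>x. x \<bullet> (A *v x))"
    by (intro continuous_intros linear_continuous_on linear_linear[THEN iffD2]
        matrix_vector_mul_linear)
  ultimately obtain x where x: "x \<in> ?K" and max: "\<And>y. y \<in> ?K \<Longrightarrow> y \<bullet> (A *v y) \<le> x \<bullet> (A *v x)"
    using continuous_attains_sup[of ?K "\<lambda>x. x \<bullet> (A *v x)"] by blast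
  define l where "l = x \<bullet> (A *v x)"
  define r where "r = A *v x - l *\<^sub>R x"
  have nx: "x \<bullet> x = 1"
    using x by (simp add: norm_eq_sqrt_inner)
  have rS: "r \<in> S"
    using x S unfolding r_def by (simp add: subspace_diff subspace_scale)
  have rx: "r \<bullet> x = 0"
    by (simp add: r_def l_def nx inner_diff_left inner_diff_right inner_commute)
  have rA: "r \<bullet> (A *v x) = r \<bullet> r"
    using rx by (simp add: r_def inner_diff_right)
  have bound: "y \<bullet> (A *v y) \<le> l * (y \<bullet> y)" if "y \<in> S" for y
  proof (cases "y = 0")
    case False
    have "y /\<^sub>R norm y \<in> ?K"
      using False that S by (simp add: subspace_scale)
    from max[OF this] have "(y \<bullet> (A *v y)) / (norm y)\<^sup>2 \<le> l"
      by (simp add: matrix_vector_mult_scaleR_right l_def power2_eq_square divide_inverse mult_ac)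
    then show ?thesis
      using False by (simp add: divide_le_eq power2_norm_eq_inner)
  qed simp
  have sa: "x \<bullet> (A *v r) = r \<bullet> (A *v x)"
    using A by (simp add: inner_adj_mult_vec[of x] herm_def inner_commute)
  \<comment> \<open>This is \<open>bound\<close> at the vector \<open>x + t *\<^sub>R r\<close>: the
    zeroth-order terms cancel, and the first-order term is \<open>2 * t * (r \<bullet> r)\<close> by
    \<open>rA\<close> and \<open>sa\<close>.\<close>
  have quad: "2 * t * (r \<bullet> r) \<le> t\<^sup>2 * (l * (r \<bullet> r) - r \<bullet> (A *v r))" for t
    using bound[of "x + t *\<^sub>R r"] S x rS rx nx sa rA
    by (simp add: subspace_add subspace_scale matrix_vector_right_distrib matrix_vector_mult_scaleR_right
        inner_add_left inner_add_right inner_commute[of x r] power2_eq_square algebra_simps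
        flip: l_def)
  have "r = 0"
  proof (rule ccontr)
    assume "r \<noteq> 0"
    then have p: "r \<bullet> r > 0" by simp
    \<comment> \<open>\<open>c\<close> is a positive majorant of the quadratic coefficient. At
      \<open>t = (r \<bullet> r) / c\<close> the inequality would say that twice the positive number
      \<open>(r \<bullet> r)\<^sup>2 / c\<close> is at most that number.\<close>
    define c where "c = max 1 (l * (r \<bullet> r) - r \<bullet> (A *v r))"
    have c: "c \<ge> 1" "l * (r \<bullet> r) - r \<bullet> (A *v r) \<le> c"
      by (auto simp: c_def)
    let ?t = "(r \<bullet> r) / c"
    have "2 * ?t * (r \<bullet> r) \<le> ?t\<^sup>2 * c"
      by (rule order_trans[OF quad mult_left_mono]) (use c in auto)
    then show False
      using c mult_pos_pos[OF p p] by (simp add: power2_eq_square field_simps del: inner_gt_zero_iff)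
  qed
  then show thesis
    using that[of x l] x by (simp add: r_def)
qed

text \<open>A substitute for counting complex dimensions: the matrix with rows
  \<open>cnj (v i)\<close> for \<open>i\<close> in \<open>J\<close> and zero rows elsewhere has a
  zero row \<open>j\<close>, hence no right inverse. Being square, it has no left inverse either, so
  its kernel is nontrivial.\<close>

lemma exists_orthogonal_vector:
  fixes v :: "'n::finite \<Rightarrow> complex^'n"
  assumes "j \<notin> J"
  obtains x where "x \<noteq> 0" "\<And>i. i \<in> J \<Longrightarrow> (\<Sum>k\<in>UNIV. cnj (v i $ k) * x $ k) = 0"
proof -
  define R :: "complex^'n^'n" where "R = (\<chi> i k. if i \<in> J then cnj (v i $ k) else 0)"
  have "R ** B \<noteq> mat 1" for B
  proof
    assume "R ** B = mat 1"
    then have "(R ** B) $ j $ j = 1" by (simp add: mat_def)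
    then show False using assms by (simp add: R_def matrix_matrix_mult_def)
  qed
  then have "\<not> (\<exists>B. B ** R = mat 1)"
    using matrix_left_right_inverse by blast
  then obtain x where x: "x \<noteq> 0" "R *v x = 0"
    by (auto simp: matrix_left_invertible_ker)
  have "(\<Sum>k\<in>UNIV. cnj (v i $ k) * x $ k) = 0" if "i \<in> J" for i
    using arg_cong[OF x(2), of "\<lambda>y. y $ i"] that by (simp add: R_def matrix_vector_mult_def)
  then show thesis
    using that x by blast
qed

text \<open>One eigenvector is added per index, taken from the orthogonal complement
  \<open>S\<close> of those already found; \<open>S\<close> is invariant because \<open>A\<close> is
  self-adjoint and acts on each \<open>v i\<close> by a real scalar. Orthogonality is written as a
  complex sum, since \<bullet> would control only the real part.\<close>

lemma hermitian_orthonormal_eigenvectors: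
  fixes A :: "complex^'n^'n"
  assumes A: "A \<in> herm" and "finite (J :: 'n set)"
  shows "\<exists>v d. \<forall>i\<in>J. A *v v i = (d i :: real) *\<^sub>R v i \<and>
           (\<forall>i'\<in>J. (\<Sum>k\<in>UNIV. cnj (v i $ k) * v i' $ k) = (if i = i' then 1 else 0))"
  using \<open>finite J\<close>
proof induction
  case (insert j J)
  then obtain v d where vd: "\<And>i. i \<in> J \<Longrightarrow> A *v v i = (d i :: real) *\<^sub>R v i"
    and on: "\<And>i i'. i \<in> J \<Longrightarrow> i' \<in> J \<Longrightarrow>
      (\<Sum>k\<in>UNIV. cnj (v i $ k) * v i' $ k) = (if i = i' then 1 else 0)"
    by blast
  define S where "S = {x. \<forall>i\<in>J. (\<Sum>k\<in>UNIV. cnj (v i $ k) * x $ k) = 0}"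
  have "subspace S"
    unfolding subspace_def S_def
    by (auto simp: sum.distrib algebra_simps simp flip: scaleR_sum_right)
  moreover have "S \<noteq> {0}"
  proof -
    obtain x where "x \<noteq> 0" "\<And>i. i \<in> J \<Longrightarrow> (\<Sum>k\<in>UNIV. cnj (v i $ k) * x $ k) = 0"
      using exists_orthogonal_vector[OF insert(2), of v] by metis
    then have "x \<in> S" "x \<noteq> 0"
      by (simp_all add: S_def)
    then show ?thesis
      by auto
  qed
  moreover have "A *v x \<in> S" if "x \<in> S" for x
  proof -
    have "(\<Sum>k\<in>UNIV. cnj (v i $ k) * (A *v x) $ k) = 0" if i: "i \<in> J" for i
    proof -
      have "(\<Sum>k\<in>UNIV. cnj (v i $ k) * (A *v x) $ k) =
            (\<Sum>k\<in>UNIV. \<Sum>m\<in>UNIV. cnj (v i $ k) * A $ k $ m * x $ m)"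
        by (simp add: matrix_vector_mult_def sum_distrib_left mult.assoc)
      also have "\<dots> = (\<Sum>m\<in>UNIV. (\<Sum>k\<in>UNIV. cnj (v i $ k) * A $ k $ m) * x $ m)"
        unfolding sum_distrib_right by (rule sum.swap)
      also have "\<dots> = (\<Sum>m\<in>UNIV. cnj ((adj A *v v i) $ m) * x $ m)"
        by (simp add: matrix_vector_mult_def mult.commute)
      also have "adj A *v v i = d i *\<^sub>R v i"
        using A vd i by (simp add: herm_def)
      also have "(\<Sum>m\<in>UNIV. cnj ((d i *\<^sub>R v i) $ m) * x $ m) =
          d i *\<^sub>R (\<Sum>m\<in>UNIV. cnj (v i $ m) * x $ m)"
        by (simp add: scaleR_sum_right)
      also have "\<dots> = 0"
        using \<open>x \<in> S\<close> i by (simp add: S_def)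
      finally show ?thesis .
    qed
    then show ?thesis by (simp add: S_def)
  qed
  ultimately obtain x l where x: "x \<in> S" "norm x = 1" "A *v x = (l::real) *\<^sub>R x"
    using hermitian_eigenvector[OF A, of S] by metis
  have xx: "(\<Sum>k\<in>UNIV. cnj (x $ k) * x $ k) = 1"
  proof -
    have "(\<Sum>k\<in>UNIV. cnj (x $ k) * x $ k) = of_real (\<Sum>k\<in>UNIV. (norm (x $ k))\<^sup>2)"
      unfolding of_real_sum by (intro sum.cong refl) (metis complex_norm_square mult.commute)
    also have "(\<Sum>k\<in>UNIV. (norm (x $ k))\<^sup>2) = (norm x)\<^sup>2"
      by (simp add: norm_vec_def L2_set_def sum_nonneg)
    finally show ?thesis using x by simp
  qed
  have vx: "(\<Sum>k\<in>UNIV. cnj (v i $ k) * x $ k) = 0" if "i \<in> J" for i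
    using x that by (simp add: S_def)
  have xv: "(\<Sum>k\<in>UNIV. cnj (x $ k) * v i $ k) = 0" if "i \<in> J" for i
    using arg_cong[OF vx[OF that], of cnj] by (simp add: mult.commute)
  define v' where "v' = v(j := x)"
  define d' where "d' = d(j := l)"
  have old: "v' i = v i" "d' i = d i" if "i \<in> J" for i
    using that insert(2) by (auto simp: v'_def d'_def)
  have new: "v' j = x" "d' j = l"
    by (auto simp: v'_def d'_def)
  have "A *v v' i = d' i *\<^sub>R v' i" if "i \<in> insert j J" for i
    using that vd old new x(3) by (cases "i = j") auto
  moreover have "(\<Sum>k\<in>UNIV. cnj (v' i $ k) * v' i' $ k) = (if i = i' then 1 else 0)"
    if "i \<in> insert j J" "i' \<in> insert j J" for i i'
    using that on[of i i'] old new xx vx xv insert(2) by (cases "i = j"; cases "i' = j") simp_all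
  ultimately show ?case
    by (intro exI[of _ v'] exI[of _ d'] ballI conjI) auto
qed auto

theorem hermitian_diagonalization:
  fixes A :: "complex^'n^'n"
  assumes A: "A \<in> herm"
  obtains U d where "unitary_op U" "A = U ** diag_op d ** adj U"
proof -
  obtain v :: "'n \<Rightarrow> complex^'n" and d where all: "\<forall>i\<in>UNIV. A *v v i = (d i :: real) *\<^sub>R v i \<and>
      (\<forall>i'\<in>UNIV. (\<Sum>k\<in>UNIV. cnj (v i $ k) * v i' $ k) = (if i = i' then 1 else 0))"
    using hermitian_orthonormal_eigenvectors[OF A finite_class.finite_UNIV] by blast
  have vd: "A *v v i = d i *\<^sub>R v i"
    and on: "(\<Sum>k\<in>UNIV. cnj (v i $ k) * v i' $ k) = (if i = i' then 1 else 0)" for i i'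
    using all by blast+
  define U where "U = (\<chi> i j. v j $ i)"
  have "adj U ** U = mat 1"
    by (simp add: vec_eq_iff matrix_matrix_mult_def U_def on mat_def)
  then have U: "unitary_op U"
    using matrix_left_right_inverse unfolding unitary_op_def by blast
  have "A ** U = U ** diag_op d"
  proof -
    have "(A ** U) $ i $ j = (A *v v j) $ i" for i j
      by (simp add: matrix_matrix_mult_def matrix_vector_mult_def U_def)
    moreover have "(d j *\<^sub>R v j) $ i = v j $ i * of_real (d j)" for i j
      by (simp only: vector_scaleR_component) (simp add: scaleR_conv_of_real)
    ultimately show ?thesis
      by (simp add: vec_eq_iff vd diag_op_mult_right U_def)
  qed
  then have "A = U ** diag_op d ** adj U"
    by (metis U matrix_mul_assoc matrix_mul_rid unitary_op_def)
  then show thesis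
    using that U by blast
qed

subsection \<open>Functional calculus and Klein's inequality\<close>

lemma fun_calc_herm:
  assumes "A \<in> herm" shows "fun_calc f A \<in> herm"
proof -
  obtain U d where U: "unitary_op U" and A: "A = U ** diag_op d ** adj U"
    using hermitian_diagonalization[OF assms] by blast
  show ?thesis
    by (simp add: A fun_calc_diag[OF U] herm_diag_conj)
qed

lemma diag_op_const: "diag_op (\<lambda>_. c) = c *\<^sub>R mat 1"
  by (simp add: vec_eq_iff diag_op_def mat_def complex_eq_iff)

lemma diag_op_add: "diag_op (\<lambda>i. d i + e i) = diag_op d + diag_op e"
  by (simp add: vec_eq_iff diag_op_def)

lemma diag_op_mult: "diag_op (\<lambda>i. d i * e i) = diag_op d ** diag_op e"
  by (simp add: vec_eq_iff diag_op_mult_left) (simp add: diag_op_def)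

lemma diag_op_scaleR: "diag_op (\<lambda>i. c * d i) = c *\<^sub>R diag_op d"
  by (simp add: vec_eq_iff diag_op_def complex_eq_iff)

text \<open>The rules for constants, the identity, sums and products are what Stone--Weierstrass
  asks of the functions whose calculus is continuous.\<close>

lemma fun_calc_const:
  assumes "A \<in> herm" shows "fun_calc (\<lambda>_. c) A = c *\<^sub>R mat 1"
proof -
  obtain U d where U: "unitary_op U" and A: "A = U ** diag_op d ** adj U"
    using hermitian_diagonalization[OF assms] by blast
  have "fun_calc (\<lambda>_. c) A = U ** (c *\<^sub>R mat 1) ** adj U"
    by (simp add: A fun_calc_diag[OF U] diag_op_const)
  then show ?thesis
    using U by (simp add: matrix_mult_add_scaleR unitary_op_def)
qed

lemma fun_calc_ident:
  assumes "A \<in> herm" shows "fun_calc (\<lambda>x. x) A = A"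
proof -
  obtain U d where U: "unitary_op U" and A: "A = U ** diag_op d ** adj U"
    using hermitian_diagonalization[OF assms] by blast
  show ?thesis
    by (simp add: A fun_calc_diag[OF U])
qed

lemma fun_calc_add:
  assumes "A \<in> herm" shows "fun_calc (\<lambda>x. f x + g x) A = fun_calc f A + fun_calc g A"
proof -
  obtain U d where U: "unitary_op U" and A: "A = U ** diag_op d ** adj U"
    using hermitian_diagonalization[OF assms] by blast
  show ?thesis
    by (simp add: A fun_calc_diag[OF U] diag_op_add matrix_mult_add_scaleR)
qed

lemma fun_calc_mult:
  assumes "A \<in> herm" shows "fun_calc (\<lambda>x. f x * g x) A = fun_calc f A ** fun_calc g A"
proof -
  obtain U d where U: "unitary_op U" and A: "A = U ** diag_op d ** adj U"
    using hermitian_diagonalization[OF assms] by blast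
  have "fun_calc f A ** fun_calc g A =
      U ** diag_op (\<lambda>i. f (d i)) ** (adj U ** U) ** diag_op (\<lambda>i. g (d i)) ** adj U"
    by (simp add: A fun_calc_diag[OF U] matrix_mul_assoc)
  also have "\<dots> = U ** (diag_op (\<lambda>i. f (d i)) ** diag_op (\<lambda>i. g (d i))) ** adj U"
    using U by (simp add: unitary_op_def matrix_mul_assoc)
  finally show ?thesis
    by (simp add: A fun_calc_diag[OF U] diag_op_mult)
qed

lemma norm_diag_conj:
  assumes "unitary_op U"
  shows "norm (U ** diag_op d ** adj U) = L2_set d UNIV"
proof -
  let ?X = "U ** diag_op d ** adj U"
  have "?X \<bullet> ?X = hs_inner ?X ?X"
    by (simp add: hs_inner_herm herm_diag_conj)
  also have "\<dots> = (\<Sum>i\<in>UNIV. d i * (column i U \<bullet> (d i *\<^sub>R column i U)))"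
    by (simp only: hs_inner_diag_conj column_diag_conj[OF assms])
  also have "\<dots> = (\<Sum>i\<in>UNIV. (d i)\<^sup>2)"
    by (simp add: unitary_norm_column[OF assms] dot_square_norm power2_eq_square)
  finally show ?thesis
    by (simp add: norm_eq_sqrt_inner L2_set_def)
qed

text \<open>Spectrum in the interval from \<open>a\<close> to \<open>b\<close>, expressed by quadratic forms, which behave well under
  sums and convex combinations.\<close>

definition herm_between :: "real \<Rightarrow> real \<Rightarrow> (complex^'n^'n) set" where
  "herm_between a b =
     {A \<in> herm. \<forall>x. a * (x \<bullet> x) \<le> x \<bullet> (A *v x) \<and> x \<bullet> (A *v x) \<le> b * (x \<bullet> x)}"

lemma inner_column_diag_conj:
  assumes "unitary_op U"
  shows "column i U \<bullet> ((U ** diag_op d ** adj U) *v column i U) = d i"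
  by (simp add: column_diag_conj[OF assms] dot_square_norm unitary_norm_column[OF assms])

lemma herm_between_diag_conjD:
  assumes "unitary_op U" "U ** diag_op d ** adj U \<in> herm_between a b"
  shows "d i \<in> {a..b}"
proof -
  have "column i U \<bullet> column i U = 1"
    by (simp add: dot_square_norm unitary_norm_column[OF assms(1)])
  moreover have "a * (x \<bullet> x) \<le> x \<bullet> ((U ** diag_op d ** adj U) *v x)"
    "x \<bullet> ((U ** diag_op d ** adj U) *v x) \<le> b * (x \<bullet> x)" for x
    using assms(2) by (auto simp: herm_between_def)
  note this[of "column i U"]
  ultimately show ?thesis
    by (simp add: inner_column_diag_conj[OF assms(1)])
qed

section \<open>Continuity of the functional calculus\<close>

lemma continuous_on_approx:
  fixes f :: "'a :: metric_space \<Rightarrow> 'b :: metric_space"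
  assumes "\<And>e. e > 0 \<Longrightarrow> \<exists>g. continuous_on S g \<and> (\<forall>x\<in>S. dist (f x) (g x) < e)"
  shows "continuous_on S f"
  unfolding continuous_on_iff
proof (intro ballI allI impI)
  fix x and e :: real assume x: "x \<in> S" and "e > 0"
  then obtain g where g: "continuous_on S g" and close: "\<And>y. y \<in> S \<Longrightarrow> dist (f y) (g y) < e / 3"
    using assms[of "e / 3"] by auto
  obtain r where r: "r > 0" "\<And>y. y \<in> S \<Longrightarrow> dist y x < r \<Longrightarrow> dist (g y) (g x) < e / 3"
    using g x \<open>e > 0\<close> unfolding continuous_on_iff by (metis zero_less_divide_iff zero_less_numeral)
  have "dist (f y) (f x) < e" if "y \<in> S" "dist y x < r" for y
  proof -
    have "dist (f y) (f x) \<le> dist (f y) (g y) + dist (g y) (g x) + dist (f x) (g x)"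
      by metric
    then show ?thesis
      using close[of y] close[of x] r(2)[of y] that x by linarith
  qed
  then show "\<exists>d>0. \<forall>x'\<in>S. dist x' x < d \<longrightarrow> dist (f x') (f x) < e"
    using r by blast
qed

lemma continuous_on_matrix_mult:
  fixes f g :: "'a::topological_space \<Rightarrow> complex^'n^'n"
  shows "continuous_on S f \<Longrightarrow> continuous_on S g \<Longrightarrow> continuous_on S (\<lambda>x. f x ** g x)"
  unfolding matrix_matrix_mult_def by (intro continuous_intros)

text \<open>The functions \<open>g\<close> such that \<open>g\<close> and \<open>fun_calc g\<close>
  are both continuous form an algebra that contains the constants and separates points, so they
  approximate \<open>f\<close> uniformly on the interval. Closeness passes to operators because the
  norm of \<open>fun_calc\<close> of a difference is the l2 norm of its values at the
  eigenvalues.\<close>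

lemma continuous_on_fun_calc:
  assumes f: "continuous_on {a..b} f"
  shows "continuous_on (herm_between a b) (fun_calc f :: complex^'n^'n \<Rightarrow> _)"
proof (rule continuous_on_approx)
  let ?S = "herm_between a b :: (complex^'n^'n) set"
  fix e :: real assume "e > 0"
  define P where "P = (\<lambda>g. continuous_on {a..b} g \<and> continuous_on ?S (fun_calc g))"
  have S: "A \<in> herm" if "A \<in> ?S" for A
    using that by (simp add: herm_between_def)
  \<comment> \<open>The l2 norm is bounded by a sum over \<open>n\<close> eigenvalues, so each of
    them gets the share \<open>e / n\<close>.\<close>
  define n where "n = real CARD('n)"
  have n: "n > 0" by (simp add: n_def)
  have "\<exists>g. P g \<and> (\<forall>x \<in> {a..b}. \<bar>f x - g x\<bar> < e / n)"
  proof (rule Stone_Weierstrass_HOL[where P = P])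
    show "P (\<lambda>x. c)" for c
      by (simp add: P_def S fun_calc_const cong: continuous_on_cong)
    show "P (\<lambda>x. g x + h x)" if "P g \<and> P h" for g h
      using that by (auto simp: P_def S fun_calc_add cong: continuous_on_cong intro!: continuous_intros)
    show "P (\<lambda>x. g x * h x)" if "P g \<and> P h" for g h
      using that by (auto simp: P_def S fun_calc_mult cong: continuous_on_cong
          intro!: continuous_intros continuous_on_matrix_mult)
    show "\<exists>g. P g \<and> g x \<noteq> g y" if "x \<in> {a..b} \<and> y \<in> {a..b} \<and> x \<noteq> y" for x y
      using that by (intro exI[of _ "\<lambda>x. x"])
        (simp add: P_def S fun_calc_ident cong: continuous_on_cong)
  qed (use f \<open>e > 0\<close> n in \<open>auto simp: P_def\<close>)
  then obtain g where g: "P g" and close: "\<And>x. x \<in> {a..b} \<Longrightarrow> \<bar>f x - g x\<bar> < e / n"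
    by blast
  have "dist (fun_calc f A) (fun_calc g A) < e" if A: "A \<in> ?S" for A
  proof -
    obtain U d where U: "unitary_op U" and Ad: "A = U ** diag_op d ** adj U"
      using hermitian_diagonalization[OF S[OF A]] by blast
    have d: "d i \<in> {a..b}" for i
      using herm_between_diag_conjD[OF U] A Ad by blast
    have "fun_calc f A = fun_calc (\<lambda>x. f x - g x) A + fun_calc g A"
      using fun_calc_add[OF S[OF A], of "\<lambda>x. f x - g x" g] by simp
    then have "dist (fun_calc f A) (fun_calc g A) = norm (fun_calc (\<lambda>x. f x - g x) A)"
      by (simp add: dist_norm)
    also have "\<dots> = L2_set (\<lambda>i. f (d i) - g (d i)) UNIV"
      unfolding Ad fun_calc_diag[OF U] norm_diag_conj[OF U] ..
    also have "\<dots> \<le> (\<Sum>i\<in>UNIV. \<bar>f (d i) - g (d i)\<bar>)"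
      by (rule L2_set_le_sum_abs)
    also have "\<dots> < (\<Sum>i\<in>(UNIV::'n set). e / n)"
      by (intro sum_strict_mono close d) auto
    also have "\<dots> = e"
      using n by (simp add: n_def)
    finally show ?thesis .
  qed
  then show "\<exists>g. continuous_on ?S g \<and> (\<forall>A\<in>?S. dist (fun_calc f A) (g A) < e)"
    using g unfolding P_def by blast
qed

text \<open>At 0 the factor \<open>x\<close> makes the value 0 whatever \<open>ln 0\<close> is, and
  this agrees with the limit from the right.\<close>

lemma continuous_on_x_ln_x: "continuous_on {0..} (\<lambda>x::real. x * ln x)"
  unfolding continuous_on_def
proof
  fix x :: real assume "x \<in> {0..}"
  then have "x = 0 \<or> x > 0" by auto
  then show "((\<lambda>x. x * ln x) \<longlongrightarrow> x * ln x) (at x within {0..})"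
  proof
    assume "x = 0"
    have "((\<lambda>x::real. x * ln x) \<longlongrightarrow> 0) (at_right 0)"
      by real_asymp
    then show ?thesis
      using \<open>x = 0\<close> by (simp add: at_within_Ici_at_right)
  qed (auto intro!: tendsto_intros)
qed

section \<open>Positivity in terms of eigenvalues, and Klein's inequality\<close>

lemma pos_semidef_diag_conj:
  assumes U: "unitary_op U"
  shows "pos_semidef (U ** diag_op d ** adj U) \<longleftrightarrow> (\<forall>i. 0 \<le> d i)"
proof
  show "pos_semidef (U ** diag_op d ** adj U) \<Longrightarrow> \<forall>i. 0 \<le> d i"
    unfolding pos_semidef_def by (metis inner_column_diag_conj[OF U])
  show "\<forall>i. 0 \<le> d i \<Longrightarrow> pos_semidef (U ** diag_op d ** adj U)"
    by (simp add: pos_semidef_def herm_diag_conj inner_diag_conj sum_nonneg)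
qed

lemma pos_def_diag_conj:
  assumes U: "unitary_op U"
  shows "pos_def (U ** diag_op d ** adj U) \<longleftrightarrow> (\<forall>i. 0 < d i)"
proof
  assume *: "pos_def (U ** diag_op d ** adj U)"
  have "column i U \<noteq> 0" for i
    using unitary_norm_column[OF U, of i] by auto
  then show "\<forall>i. 0 < d i"
    using * unfolding pos_def_def by (metis inner_column_diag_conj[OF U])
next
  assume d: "\<forall>i. 0 < d i"
  have "0 < x \<bullet> ((U ** diag_op d ** adj U) *v x)" if "x \<noteq> 0" for x
  proof -
    have "norm (adj U *v x) \<noteq> 0"
      using that by (simp add: norm_unitary_mult_vec unitary_adj U del: norm_eq_zero) simp
    then obtain j where "(adj U *v x) $ j \<noteq> 0"
      by (metis norm_zero vec_eq_iff zero_index)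
    then have "0 < d j * (norm ((adj U *v x) $ j))\<^sup>2"
      using d by simp
    then show ?thesis
      unfolding inner_diag_conj using d by (intro sum_pos2[of _ j]) (auto simp: less_imp_le)
  qed
  then show "pos_def (U ** diag_op d ** adj U)"
    by (simp add: pos_def_def herm_diag_conj)
qed

lemma pos_def_imp_pos_semidef: "pos_def A \<Longrightarrow> pos_semidef A"
  unfolding pos_def_def pos_semidef_def
  by (metis inner_zero_left less_imp_le order_refl)

lemma sum_norm_unitary_mult_vec:
  assumes "unitary_op U" shows "(\<Sum>j\<in>UNIV. (norm ((U *v x) $ j))\<^sup>2) = (norm x)\<^sup>2"
proof -
  have "(norm (U *v x))\<^sup>2 = (\<Sum>j\<in>UNIV. (norm ((U *v x) $ j))\<^sup>2)"
    by (simp add: norm_vec_def L2_set_def sum_nonneg)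
  then show ?thesis
    using norm_unitary_mult_vec[OF assms] by metis
qed

text \<open>The squared moduli of the entries of a unitary form a doubly stochastic matrix, which reduces
  the operator inequality to the scalar inequality \<open>ln x \<le> x - 1\<close>.\<close>

theorem Klein_inequality:
  fixes \<sigma> \<tau> :: "complex^'n^'n"
  assumes "pos_semidef \<sigma>" "pos_def \<tau>"
  shows "hs_inner \<sigma> (mat 1) - hs_inner \<tau> (mat 1) \<le> rel_entropy \<sigma> \<tau>"
proof -
  obtain U d where U: "unitary_op U" and \<sigma>: "\<sigma> = U ** diag_op d ** adj U"
    using hermitian_diagonalization assms(1) unfolding pos_semidef_def by blast
  obtain V e where V: "unitary_op V" and \<tau>: "\<tau> = V ** diag_op e ** adj V"
    using hermitian_diagonalization assms(2) unfolding pos_def_def by blast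
  have d: "0 \<le> d i" and e: "0 < e i" for i
    using assms pos_semidef_diag_conj[OF U] pos_def_diag_conj[OF V] \<sigma> \<tau> by auto
  \<comment> \<open>\<open>w i j\<close> is the squared overlap of the \<open>i\<close>-th
    eigenvector of \<sigma> with the \<open>j\<close>-th eigenvector of \<tau>; rows and columns sum
    to 1 because unitaries preserve the norm.\<close>
  define w where "w i j = (norm ((adj V *v column i U) $ j))\<^sup>2" for i j
  have row: "(\<Sum>j\<in>UNIV. w i j) = 1" for i
    unfolding w_def using sum_norm_unitary_mult_vec[OF unitary_adj[OF V]] unitary_norm_column[OF U]
    by simp
  have "w i j = (norm ((adj U *v column j V) $ i))\<^sup>2" for i j
  proof -
    have "(adj V *v column i U) $ j = (adj V ** U) $ j $ i"
      unfolding column_matrix_mult[symmetric] by (simp add: column_def)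
    also have "\<dots> = cnj ((adj U ** V) $ i $ j)"
      using adj_mult[of "adj U" V] by (metis adj_adj adj_nth)
    also have "(adj U ** V) $ i $ j = (adj U *v column j V) $ i"
      unfolding column_matrix_mult[symmetric] by (simp add: column_def)
    finally show ?thesis
      by (simp add: w_def)
  qed
  then have col: "(\<Sum>i\<in>UNIV. w i j) = 1" for j
    using sum_norm_unitary_mult_vec[OF unitary_adj[OF U], of "column j V"] unitary_norm_column[OF V]
    by simp
  have "rel_entropy \<sigma> \<tau> = hs_inner \<sigma> (op_log \<sigma>) - hs_inner \<sigma> (op_log \<tau>)"
    by (simp add: rel_entropy_def hs_inner_adj inner_diff_right flip: hs_inner_def)
  also have "hs_inner \<sigma> (op_log \<sigma>) = (\<Sum>i\<in>UNIV. \<Sum>j\<in>UNIV. d i * ln (d i) * w i j)"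
    unfolding \<sigma> op_log_def fun_calc_diag[OF U] hs_inner_diag_conj
    by (simp add: inner_column_diag_conj[OF U] row flip: sum_distrib_left)
  also have "hs_inner \<sigma> (op_log \<tau>) = (\<Sum>i\<in>UNIV. \<Sum>j\<in>UNIV. d i * ln (e j) * w i j)"
    unfolding \<sigma> \<tau> op_log_def fun_calc_diag[OF V] hs_inner_diag_conj inner_diag_conj
    by (simp add: w_def sum_distrib_left mult.assoc)
  finally have "rel_entropy \<sigma> \<tau> = (\<Sum>i\<in>UNIV. \<Sum>j\<in>UNIV. (d i * ln (d i) - d i * ln (e j)) * w i j)"
    by (simp add: left_diff_distrib sum_subtractf)
  also have "\<dots> \<ge> (\<Sum>i\<in>UNIV. \<Sum>j\<in>UNIV. (d i - e j) * w i j)"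
  proof (intro sum_mono mult_right_mono)
    show "0 \<le> w i j" for i j
      by (simp add: w_def)
    \<comment> \<open>For \<open>d i = 0\<close> this reads \<open>- e j \<le> 0\<close>. Otherwise
      it is \<open>ln x \<le> x - 1\<close> at \<open>x = e j / d i\<close>, multiplied by
      \<open>d i\<close>.\<close>
    show "d i - e j \<le> d i * ln (d i) - d i * ln (e j)" for i j
    proof (cases "d i = 0")
      case False
      then have p: "d i > 0"
        using d[of i] by simp
      have "ln (e j / d i) \<le> e j / d i - 1"
        using e p by (intro ln_le_minus_one) simp
      then have "d i * (ln (e j) - ln (d i)) \<le> d i * (e j / d i - 1)"
        using p e[of j] by (intro mult_left_mono) (simp_all add: ln_div)
      then show ?thesis
        using p by (simp add: algebra_simps)
    qed (use e[of j] in simp)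
  qed
  also have "(\<Sum>i\<in>UNIV. \<Sum>j\<in>UNIV. (d i - e j) * w i j) =
      (\<Sum>i\<in>UNIV. d i * (\<Sum>j\<in>UNIV. w i j)) - (\<Sum>i\<in>UNIV. \<Sum>j\<in>UNIV. e j * w i j)"
    by (simp add: left_diff_distrib sum_subtractf sum_distrib_left)
  also have "(\<Sum>i\<in>UNIV. \<Sum>j\<in>UNIV. e j * w i j) = (\<Sum>j\<in>UNIV. e j * (\<Sum>i\<in>UNIV. w i j))"
    unfolding sum_distrib_left by (rule sum.swap)
  finally have "rel_entropy \<sigma> \<tau> \<ge> (\<Sum>i\<in>UNIV. d i) - (\<Sum>j\<in>UNIV. e j)"
    by (simp add: row col)
  moreover have "hs_inner (U ** diag_op d ** adj U) (mat 1) = (\<Sum>i\<in>UNIV. d i)"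
    if "unitary_op U" for U and d :: "'n \<Rightarrow> real"
    by (simp add: hs_inner_diag_conj dot_square_norm unitary_norm_column[OF that])
  ultimately show ?thesis
    using U V \<sigma> \<tau> by simp
qed

subsection \<open>Entropy minimisation over the feasible set\<close>

lemma hs_inner_add_left: "hs_inner (X + Y) Z = hs_inner X Z + hs_inner Y Z"
  and hs_inner_diff_left: "hs_inner (X - Y) Z = hs_inner X Z - hs_inner Y Z"
  and hs_inner_scaleR_left: "hs_inner (r *\<^sub>R X) Z = r * hs_inner X Z"
  and hs_inner_add_right: "hs_inner Z (X + Y) = hs_inner Z X + hs_inner Z Y"
  and hs_inner_diff_right: "hs_inner Z (X - Y) = hs_inner Z X - hs_inner Z Y"
  and hs_inner_scaleR_right: "hs_inner Z (r *\<^sub>R X) = r * hs_inner Z X"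
  unfolding hs_inner_commute[of _ Z]
  by (simp_all add: hs_inner_adj inner_add_right inner_diff_right)

lemmas hs_inner_linear = hs_inner_add_left hs_inner_diff_left hs_inner_scaleR_left
  hs_inner_add_right hs_inner_diff_right hs_inner_scaleR_right

lemma continuous_on_hs_inner:
  "continuous_on S f \<Longrightarrow> continuous_on S (\<lambda>x. hs_inner X (f x))"
  unfolding hs_inner_adj by (intro continuous_intros)

lemma hs_inner_mat_1: "hs_inner A (mat 1) = Re (trace A)"
  by (simp add: hs_inner_def)

lemma herm_between_diag_conjI:
  assumes U: "unitary_op U" and d: "\<And>i. d i \<in> {a..b}"
  shows "U ** diag_op d ** adj U \<in> herm_between a b"
proof -
  have sq: "x \<bullet> x = (\<Sum>j\<in>UNIV. (norm ((adj U *v x) $ j))\<^sup>2)" for x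
    using sum_norm_unitary_mult_vec[OF unitary_adj[OF U], of x] by (simp add: dot_square_norm)
  have "a * (x \<bullet> x) \<le> x \<bullet> ((U ** diag_op d ** adj U) *v x)"
    "x \<bullet> ((U ** diag_op d ** adj U) *v x) \<le> b * (x \<bullet> x)" for x
    unfolding sq inner_diag_conj sum_distrib_left
    using d by (auto intro!: sum_mono mult_right_mono)
  then show ?thesis
    by (simp add: herm_between_def herm_diag_conj)
qed

lemma herm_imp_herm_between:
  assumes "A \<in> herm" obtains K where "K > 0" "A \<in> herm_between (- K) K"
proof -
  obtain U d where U: "unitary_op U" and A: "A = U ** diag_op d ** adj U"
    using hermitian_diagonalization[OF assms] by blast
  define K where "K = Max (range (\<lambda>i. \<bar>d i\<bar>))"
  have "\<bar>d i\<bar> \<le> K" for i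
    by (simp add: K_def)
  \<comment> \<open>The added 1 keeps the bound strictly positive even for
    \<open>A = 0\<close>.\<close>
  then have "d i \<in> {- (\<bar>K\<bar> + 1)..\<bar>K\<bar> + 1}" for i
    by (smt (verit) atLeastAtMost_iff)
  then have "A \<in> herm_between (- (\<bar>K\<bar> + 1)) (\<bar>K\<bar> + 1)"
    unfolding A by (rule herm_between_diag_conjI[OF U])
  then show thesis
    by (intro that[of "\<bar>K\<bar> + 1"]) auto
qed

lemma pos_def_lower_bound:
  assumes "pos_def A" obtains \<epsilon> where "\<epsilon> > 0" "\<And>x. \<epsilon> * (x \<bullet> x) \<le> x \<bullet> (A *v x)"
proof -
  obtain U d where U: "unitary_op U" and A: "A = U ** diag_op d ** adj U"
    using hermitian_diagonalization assms unfolding pos_def_def by blast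
  have "0 < d i" for i
    using assms pos_def_diag_conj[OF U] A by blast
  then have "Min (range d) > 0"
    by simp
  moreover have "A \<in> herm_between (Min (range d)) (Max (range d))"
    unfolding A by (rule herm_between_diag_conjI[OF U]) simp
  ultimately show thesis
    using that[of "Min (range d)"] unfolding herm_between_def by blast
qed

lemma density_ops_diag_conj:
  assumes "A \<in> density_ops"
  obtains U d where "unitary_op U" "A = U ** diag_op d ** adj U"
    "\<And>i. 0 \<le> d i" "\<And>i. d i \<le> 1" "(\<Sum>i\<in>UNIV. d i) = 1"
proof -
  have A: "pos_semidef A" "A \<in> herm"
    using assms by (auto simp: density_ops_def pos_semidef_def)
  obtain U d where U: "unitary_op U" and Ad: "A = U ** diag_op d ** adj U"
    using hermitian_diagonalization[OF A(2)] by blast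
  have d: "0 \<le> d i" for i
    using A(1) pos_semidef_diag_conj[OF U] Ad by blast
  have "hs_inner A (mat 1) = (\<Sum>i\<in>UNIV. d i)"
    unfolding Ad by (simp add: hs_inner_diag_conj dot_square_norm unitary_norm_column[OF U])
  then have sum1: "(\<Sum>i\<in>UNIV. d i) = 1"
    using assms by (simp add: hs_inner_mat_1 density_ops_def)
  have "d i \<le> 1" for i
    using member_le_sum[of i UNIV d] d sum1 by simp
  then show thesis
    using that U Ad d sum1 by blast
qed

lemma density_ops_subset_herm_between: "density_ops \<subseteq> herm_between 0 1"
proof
  fix A :: "complex^'n^'n" assume "A \<in> density_ops"
  then show "A \<in> herm_between 0 1"
    by (elim density_ops_diag_conj) (auto intro!: herm_between_diag_conjI)
qed

lemma norm_density_ops: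
  assumes "A \<in> density_ops" shows "norm A \<le> 1"
proof -
  obtain U d where U: "unitary_op U" and A: "A = U ** diag_op d ** adj U"
    and d: "\<And>i. 0 \<le> d i" "(\<Sum>i\<in>UNIV. d i) = 1"
    using density_ops_diag_conj[OF assms] by metis
  have "norm A = L2_set d UNIV"
    unfolding A by (rule norm_diag_conj[OF U])
  also have "\<dots> \<le> (\<Sum>i\<in>UNIV. d i)"
    by (intro L2_set_le_sum d)
  finally show ?thesis
    using d by simp
qed

section \<open>Compactness and convexity of the feasible set\<close>

lemma compact_feasible_set:
  fixes H :: "nat \<Rightarrow> complex^'n^'n"
  shows "compact (feasible_set k H c)"
proof -
  have "closed {A :: complex^'n^'n. A \<in> herm}"
    unfolding herm_def adj_def by (auto intro!: closed_Collect_eq continuous_intros)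
  moreover have "closed {A :: complex^'n^'n. \<forall>x. 0 \<le> x \<bullet> (A *v x)}"
    unfolding matrix_vector_mult_def
    by (intro closed_Collect_all closed_Collect_le continuous_intros)
  moreover have "closed {A :: complex^'n^'n. trace A = 1}"
    unfolding trace_def by (intro closed_Collect_eq continuous_intros)
  moreover have "closed {A :: complex^'n^'n. \<forall>j. j \<in> {1..k} \<longrightarrow> hs_inner A (H j) = c j}"
    unfolding hs_inner_commute[of _ "H _"]
    by (intro closed_Collect_all closed_Collect_imp open_Collect_const closed_Collect_eq
        continuous_on_hs_inner continuous_intros)
  ultimately have "closed ({A. A \<in> herm} \<inter> {A. \<forall>x. 0 \<le> x \<bullet> (A *v x)} \<inter> {A. trace A = 1} \<inter>
      {A. \<forall>j. j \<in> {1..k} \<longrightarrow> hs_inner A (H j) = c j})"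
    by (intro closed_Int)
  also have "\<dots> = feasible_set k H c"
    by (auto simp: feasible_set_def density_ops_def pos_semidef_def)
  finally have "closed (feasible_set k H c)" .
  moreover have "bounded (feasible_set k H c)"
    unfolding bounded_iff by (intro exI[of _ 1]) (simp add: feasible_set_def norm_density_ops)
  ultimately show ?thesis
    using compact_eq_bounded_closed by blast
qed

lemma trace_scaleR: "trace (r *\<^sub>R A) = r *\<^sub>R trace (A :: complex^'n^'n)"
  by (simp add: trace_def scaleR_sum_right)

lemma matrix_vector_mult_scaleR_left: "(r *\<^sub>R A) *v x = r *\<^sub>R (A *v (x :: complex^'n))"
  by (simp add: vec_eq_iff matrix_vector_mult_def scaleR_sum_right)

lemma inner_add_scaleR_mult_vec:
  "x \<bullet> ((a *\<^sub>R A + b *\<^sub>R B) *v x) = a * (x \<bullet> (A *v x)) + b * (x \<bullet> (B *v (x :: complex^'n)))"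
  by (simp add: matrix_vector_mult_add_rdistrib matrix_vector_mult_scaleR_left inner_add_right)

lemma convex_feasible_set: "convex (feasible_set k H c)"
proof (rule convexI)
  fix A B and u v :: real
  assume *: "A \<in> feasible_set k H c" "B \<in> feasible_set k H c" "0 \<le> u" "0 \<le> v" "u + v = 1"
  have "trace (u *\<^sub>R A + v *\<^sub>R B) = u *\<^sub>R 1 + v *\<^sub>R 1"
    using *(1,2) by (simp add: feasible_set_def density_ops_def trace_add trace_scaleR)
  also have "\<dots> = 1"
    using *(5) by (simp flip: scaleR_add_left)
  finally have "trace (u *\<^sub>R A + v *\<^sub>R B) = 1" .
  moreover have "u * c j + v * c j = c j" for j
    using * by (simp flip: distrib_right)
  ultimately show "u *\<^sub>R A + v *\<^sub>R B \<in> feasible_set k H c"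
    using * by (auto simp: feasible_set_def density_ops_def pos_semidef_def herm_add herm_scaleR
        inner_add_scaleR_mult_vec hs_inner_linear)
qed

text \<open>Up to a positive factor and a constant on the feasible set, both updates minimise this
  functional, for different \<open>A\<close>.\<close>

definition tilted_entropy :: "complex^'n^'n \<Rightarrow> complex^'n^'n \<Rightarrow> real" where
  "tilted_entropy A \<sigma> = hs_inner \<sigma> (op_log \<sigma> - A)"

lemma rel_entropy_eq_tilted_entropy: "rel_entropy \<sigma> \<rho> = tilted_entropy (op_log \<rho>) \<sigma>"
  by (simp add: rel_entropy_def tilted_entropy_def hs_inner_def)

text \<open>\<open>op_log\<close> itself may jump at singular states, so
  \<open>\<sigma> ** op_log \<sigma>\<close> is treated as one functional calculus, that of
  \<open>x * ln x\<close>, which is continuous on the whole spectral interval from 0 to 1.\<close>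

lemma continuous_on_tilted_entropy: "continuous_on density_ops (tilted_entropy A)"
proof -
  let ?D = "density_ops :: (complex^'n^'n) set"
  have "continuous_on {0..1} (\<lambda>x::real. x * ln x)"
    by (rule continuous_on_subset[OF continuous_on_x_ln_x]) auto
  then have "continuous_on ?D (fun_calc (\<lambda>x. x * ln x))"
    by (rule continuous_on_subset[OF continuous_on_fun_calc density_ops_subset_herm_between])
  then have "continuous_on ?D
      (\<lambda>\<sigma>. hs_inner (mat 1) (fun_calc (\<lambda>x. x * ln x) \<sigma>) - hs_inner A \<sigma>)"
    by (intro continuous_intros continuous_on_hs_inner)
  moreover have "tilted_entropy A \<sigma> = hs_inner (mat 1) (fun_calc (\<lambda>x. x * ln x) \<sigma>) - hs_inner A \<sigma>"
    if "\<sigma> \<in> ?D" for \<sigma>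
  proof -
    have "\<sigma> \<in> herm"
      using that by (simp add: density_ops_def pos_semidef_def)
    then have "fun_calc (\<lambda>x. x * ln x) \<sigma> = \<sigma> ** op_log \<sigma>"
      by (simp add: fun_calc_mult fun_calc_ident op_log_def)
    then show ?thesis
      by (simp add: tilted_entropy_def hs_inner_diff_right hs_inner_commute[of A])
        (simp add: hs_inner_def)
  qed
  ultimately show ?thesis
    by (simp cong: continuous_on_cong)
qed

text \<open>The right side minus the left side is exactly
  \<open>rel_entropy \<sigma> \<tau>\<close>, which is nonnegative by Klein's inequality because
  both traces are 1.\<close>

lemma tilted_entropy_diff_le:
  assumes "\<sigma> \<in> density_ops" "\<tau> \<in> density_ops" "pos_def \<tau>"
  shows "tilted_entropy A \<tau> - tilted_entropy A \<sigma> \<le> hs_inner (\<tau> - \<sigma>) (op_log \<tau> - A)"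
proof -
  have "0 \<le> rel_entropy \<sigma> \<tau>"
    using Klein_inequality[of \<sigma> \<tau>] assms by (simp add: density_ops_def hs_inner_mat_1)
  then show ?thesis
    by (simp add: rel_entropy_eq_tilted_entropy tilted_entropy_def hs_inner_linear)
qed

text \<open>The eigenvalues of \<rho> are at most 1, so their logarithms are nonpositive and
  weighting them by \<tau> costs at least the factor \<epsilon>. Only the smallest eigenvalue is
  kept, and it is at most the quadratic form of \<rho> at the unit vector \<open>x\<close>.\<close>

lemma hs_inner_op_log_le:
  assumes \<rho>: "\<rho> \<in> density_ops" "pos_def \<rho>" and \<epsilon>: "\<epsilon> \<ge> 0" "\<And>x. \<epsilon> * (x \<bullet> x) \<le> x \<bullet> (\<tau> *v x)"
    and x: "norm x = 1"
  shows "hs_inner \<tau> (op_log \<rho>) \<le> \<epsilon> * ln (x \<bullet> (\<rho> *v x))"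
proof -
  obtain U d where U: "unitary_op U" and \<rho>d: "\<rho> = U ** diag_op d ** adj U"
    and d1: "\<And>i. d i \<le> 1"
    using density_ops_diag_conj[OF \<rho>(1)] by metis
  have d0: "0 < d i" for i
    using \<rho>(2) pos_def_diag_conj[OF U] \<rho>d by blast
  have xx: "x \<bullet> x = 1"
    using x by (simp add: dot_square_norm)
  obtain j where j: "d j = Min (range d)"
    using Min_in[of "range d"] by (metis finite_code finite_imageI imageE image_is_empty UNIV_not_empty)
  have "\<rho> \<in> herm_between (d j) 1"
    unfolding \<rho>d by (rule herm_between_diag_conjI[OF U]) (simp add: j d1)
  then have dj: "d j \<le> x \<bullet> (\<rho> *v x)"
    unfolding herm_between_def using xx by (metis (no_types, lifting) mem_Collect_eq mult.right_neutral)
  have le: "ln (d i) * (column i U \<bullet> (\<tau> *v column i U)) \<le> ln (d i) * \<epsilon>" for i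
  proof (rule mult_left_mono_neg)
    show "\<epsilon> \<le> column i U \<bullet> (\<tau> *v column i U)"
      using \<epsilon>(2)[of "column i U"] by (simp add: dot_square_norm unitary_norm_column[OF U])
  qed (use d0 d1 in simp)
  have "hs_inner \<tau> (op_log \<rho>) = (\<Sum>i\<in>UNIV. ln (d i) * (column i U \<bullet> (\<tau> *v column i U)))"
    unfolding \<rho>d op_log_def fun_calc_diag[OF U] by (subst hs_inner_commute) (rule hs_inner_diag_conj)
  also have "\<dots> \<le> (\<Sum>i\<in>UNIV. ln (d i) * \<epsilon>)"
    by (intro sum_mono le)
  \<comment> \<open>All terms are nonpositive, so dropping those other than \<open>j\<close> can
    only increase the sum.\<close>
  also have "\<dots> \<le> (\<Sum>i\<in>{j}. ln (d i) * \<epsilon>)"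
    by (rule sum_mono2[THEN le_imp_neg_le, of UNIV "{j}" "\<lambda>i. - (ln (d i) * \<epsilon>)", unfolded sum_negf minus_minus])
      (use d0 d1 \<epsilon> in \<open>auto simp: mult_nonpos_nonneg\<close>)
  also have "\<dots> \<le> \<epsilon> * ln (x \<bullet> (\<rho> *v x))"
    using dj d0[of j] \<epsilon>(1) by (auto simp: mult.commute intro!: mult_left_mono)
  finally show ?thesis .
qed

lemma pos_def_segment:
  assumes "pos_semidef \<sigma>" "pos_def \<tau>" "0 < t" "t \<le> 1"
  shows "pos_def ((1 - t) *\<^sub>R \<sigma> + t *\<^sub>R \<tau>)"
proof -
  have "0 < (1 - t) * (x \<bullet> (\<sigma> *v x)) + t * (x \<bullet> (\<tau> *v x))" if "x \<noteq> 0" for x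
    using assms that unfolding pos_semidef_def pos_def_def
    by (intro add_nonneg_pos mult_nonneg_nonneg mult_pos_pos) auto
  then show ?thesis
    using assms by (auto simp: pos_def_def pos_semidef_def herm_add herm_scaleR inner_add_scaleR_mult_vec)
qed

lemma pos_semidef_kernel_vector:
  assumes "pos_semidef A" "\<not> pos_def A"
  obtains x where "norm x = 1" "x \<bullet> (A *v x) = 0"
proof -
  obtain U d where U: "unitary_op U" and A: "A = U ** diag_op d ** adj U"
    using hermitian_diagonalization assms unfolding pos_semidef_def by blast
  obtain i where "d i = 0"
    using assms pos_semidef_diag_conj[OF U] pos_def_diag_conj[OF U] A
    by (metis order_le_less)
  then have "column i U \<bullet> (A *v column i U) = 0"
    unfolding A by (simp only: inner_column_diag_conj[OF U])
  then show thesis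
    using that unitary_norm_column[OF U] by blast
qed

text \<open>Towards a positive definite \<open>\<tau>\<close> the entropy has slope \<open>-\<infinity>\<close> at the boundary: on the segment
  from \<open>\<sigma>\<close> to \<open>\<tau>\<close>, a kernel vector of \<open>\<sigma>\<close> forces \<open>hs_inner \<tau> (op_log \<sigma>\<^sub>t)\<close> to \<open>-\<infinity>\<close>, while minimality
  of \<open>\<sigma>\<close> bounds it from below.\<close>

lemma tilted_entropy_minimizer_pos_def:
  assumes S: "convex S" "S \<subseteq> density_ops" and \<tau>: "\<tau> \<in> S" "pos_def \<tau>" and \<sigma>: "\<sigma> \<in> S"
    and min: "\<And>\<rho>. \<rho> \<in> S \<Longrightarrow> tilted_entropy A \<sigma> \<le> tilted_entropy A \<rho>"
  shows "pos_def \<sigma>"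
proof (rule ccontr)
  assume "\<not> pos_def \<sigma>"
  moreover have psd: "pos_semidef \<sigma>"
    using S \<sigma> by (auto simp: density_ops_def)
  ultimately obtain x where x: "norm x = 1" "x \<bullet> (\<sigma> *v x) = 0"
    using pos_semidef_kernel_vector by blast
  define \<kappa> where "\<kappa> = x \<bullet> (\<tau> *v x)"
  have \<kappa>: "\<kappa> > 0"
    using \<tau>(2) x(1) unfolding \<kappa>_def pos_def_def by (metis norm_zero zero_neq_one)
  obtain \<epsilon> where \<epsilon>: "\<epsilon> > 0" "\<And>x. \<epsilon> * (x \<bullet> x) \<le> x \<bullet> (\<tau> *v x)"
    using pos_def_lower_bound[OF \<tau>(2)] by metis
  define D where "D = \<tau> - \<sigma>"
  \<comment> \<open>A lower bound, independent of \<open>t\<close>, for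
    \<open>hs_inner \<tau> (op_log \<rho>)\<close> that minimality of \<sigma> will provide.\<close>
  define K where "K = tilted_entropy A \<sigma> - \<bar>hs_inner \<sigma> A\<bar> - \<bar>hs_inner \<tau> A\<bar> - \<bar>hs_inner D A\<bar>"
  \<comment> \<open>Since \<open>x\<close> is in the kernel of the quadratic form of \<sigma>, the
    form of \<rho> at \<open>x\<close> is \<open>t * \<kappa>\<close>. This \<open>t\<close> makes
    \<open>\<epsilon> * ln (t * \<kappa>)\<close> at most \<open>K - 1\<close>, contradicting the
    bound \<open>K\<close>; the cap 1/2 keeps \<open>t < 1\<close>.\<close>
  define t where "t = min (1 / 2) (exp ((K - 1) / \<epsilon>) / \<kappa>)"
  have t: "0 < t" "t < 1"
    using \<kappa> by (auto simp: t_def)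
  define \<rho> where "\<rho> = (1 - t) *\<^sub>R \<sigma> + t *\<^sub>R \<tau>"
  have \<rho>S: "\<rho> \<in> S"
    unfolding \<rho>_def using S \<sigma> \<tau> t by (intro convexD) auto
  have \<rho>pd: "pos_def \<rho>"
    unfolding \<rho>_def using psd \<tau> t by (intro pos_def_segment) auto
  have \<rho>\<sigma>: "\<rho> - \<sigma> = t *\<^sub>R D" and \<tau>\<rho>: "\<tau> - \<rho> = (1 - t) *\<^sub>R D"
    by (simp_all add: \<rho>_def D_def algebra_simps)
  have "0 \<le> tilted_entropy A \<rho> - tilted_entropy A \<sigma>"
    using min[OF \<rho>S] by simp
  also have "\<dots> \<le> hs_inner (\<rho> - \<sigma>) (op_log \<rho> - A)"
    using S \<sigma> \<rho>S \<rho>pd by (intro tilted_entropy_diff_le) auto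
  also have "\<dots> = t * hs_inner D (op_log \<rho> - A)"
    by (simp add: \<rho>\<sigma> hs_inner_scaleR_left)
  finally have "hs_inner D (op_log \<rho> - A) \<ge> 0"
    using t by (simp add: zero_le_mult_iff)
  \<comment> \<open>Both \<open>\<rho> - \<sigma>\<close> and \<open>\<tau> - \<rho>\<close> are
    positive multiples of \<open>D\<close>, so the slope inequality carries over from the first to
    the second.\<close>
  then have "0 \<le> (1 - t) * hs_inner D (op_log \<rho> - A)"
    using t by simp
  then have 1: "(1 - t) * hs_inner D A + hs_inner \<rho> (op_log \<rho>) \<le> hs_inner \<tau> (op_log \<rho>)"
    using arg_cong[OF \<tau>\<rho>, of "\<lambda>X. hs_inner X (op_log \<rho>)"]
    by (simp add: hs_inner_linear right_diff_distrib)
  have "\<bar>(1 - t) * hs_inner D A\<bar> \<le> \<bar>hs_inner D A\<bar>"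
    using t by (simp add: abs_mult mult_left_le_one_le)
  moreover have "hs_inner \<rho> (op_log \<rho>) \<ge> tilted_entropy A \<sigma> + hs_inner \<rho> A"
    using min[OF \<rho>S] by (simp add: tilted_entropy_def hs_inner_linear)
  moreover have "hs_inner \<rho> A = (1 - t) * hs_inner \<sigma> A + t * hs_inner \<tau> A"
    by (simp add: \<rho>_def hs_inner_linear)
  moreover have "\<bar>(1 - t) * hs_inner \<sigma> A\<bar> \<le> \<bar>hs_inner \<sigma> A\<bar>" "\<bar>t * hs_inner \<tau> A\<bar> \<le> \<bar>hs_inner \<tau> A\<bar>"
    using t by (simp_all add: abs_mult mult_left_le_one_le)
  ultimately have "K \<le> hs_inner \<tau> (op_log \<rho>)"
    using 1 unfolding K_def by linarith
  also have "\<dots> \<le> \<epsilon> * ln (x \<bullet> (\<rho> *v x))"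
    using S \<rho>S \<rho>pd \<epsilon> x by (intro hs_inner_op_log_le) auto
  also have "x \<bullet> (\<rho> *v x) = t * \<kappa>"
    by (simp add: \<rho>_def inner_add_scaleR_mult_vec x \<kappa>_def)
  also have "ln (t * \<kappa>) \<le> ln (exp ((K - 1) / \<epsilon>))"
  proof -
    have "t * \<kappa> \<le> exp ((K - 1) / \<epsilon>) / \<kappa> * \<kappa>"
      using \<kappa> by (intro mult_right_mono) (auto simp: t_def)
    then have "t * \<kappa> \<le> exp ((K - 1) / \<epsilon>)"
      using \<kappa> by simp
    then show ?thesis
      using \<kappa> t by (intro ln_mono) auto
  qed
  finally show False
    using \<epsilon>(1) by simp
qed

text \<open>If \<sigma> is bounded below by \<epsilon> and \<open>X\<close> by \<open>- K\<close>,
  then \<open>t \<le> \<epsilon> / (2 * K)\<close> costs at most half of \<epsilon>. The lower bound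
  is uniform in \<open>t\<close>, which keeps the segment in a spectral interval where
  \<open>ln\<close> is continuous; the upper bound 1 holds for every state.\<close>

lemma feasible_perturbation:
  assumes \<sigma>: "\<sigma> \<in> feasible_pd k H c" and X: "X \<in> constraint_tangents k H"
  obtains \<delta> \<epsilon> where "\<delta> > 0" "\<epsilon> > 0"
    "\<And>t. 0 \<le> t \<Longrightarrow> t \<le> \<delta> \<Longrightarrow> \<sigma> + t *\<^sub>R X \<in> feasible_pd k H c \<inter> herm_between \<epsilon> 1"
proof -
  have Xh: "X \<in> herm" and \<sigma>h: "\<sigma> \<in> herm" and pd: "pos_def \<sigma>"
    using X \<sigma> by (auto simp: constraint_tangents_def feasible_pd_def pos_def_def)
  obtain \<epsilon> where \<epsilon>: "\<epsilon> > 0" "\<And>x. \<epsilon> * (x \<bullet> x) \<le> x \<bullet> (\<sigma> *v x)"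
    using pos_def_lower_bound[OF pd] by metis
  obtain K where K: "K > 0" "X \<in> herm_between (- K) K"
    using herm_imp_herm_between[OF Xh] by blast
  have "\<sigma> + t *\<^sub>R X \<in> feasible_pd k H c \<inter> herm_between (\<epsilon> / 2) 1"
    if t: "0 \<le> t" "t \<le> \<epsilon> / (2 * K)" for t
  proof -
    have lower: "\<epsilon> / 2 * (x \<bullet> x) \<le> x \<bullet> ((\<sigma> + t *\<^sub>R X) *v x)" for x
    proof -
      have "t * K \<le> \<epsilon> / 2"
        using t K by (simp add: field_simps)
      then have "t * K * (x \<bullet> x) \<le> \<epsilon> / 2 * (x \<bullet> x)"
        by (intro mult_right_mono) auto
      moreover have "- K * (x \<bullet> x) \<le> x \<bullet> (X *v x)"
        using K unfolding herm_between_def by blast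
      then have "t * (- K * (x \<bullet> x)) \<le> t * (x \<bullet> (X *v x))"
        using t by (intro mult_left_mono)
      moreover have "x \<bullet> ((\<sigma> + t *\<^sub>R X) *v x) = x \<bullet> (\<sigma> *v x) + t * (x \<bullet> (X *v x))"
        using inner_add_scaleR_mult_vec[of x 1 \<sigma> t X] by simp
      ultimately show ?thesis
        using \<epsilon>(2)[of x] by (simp add: algebra_simps)
    qed
    have herm: "\<sigma> + t *\<^sub>R X \<in> herm"
      using \<sigma>h Xh by (intro herm_add herm_scaleR)
    have pd: "pos_def (\<sigma> + t *\<^sub>R X)"
      unfolding pos_def_def
    proof (intro conjI allI impI herm)
      fix x :: "complex^'a" assume "x \<noteq> 0"
      then have "0 < \<epsilon> / 2 * (x \<bullet> x)"
        using \<epsilon>(1) by simp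
      then show "0 < x \<bullet> ((\<sigma> + t *\<^sub>R X) *v x)"
        using lower[of x] by linarith
    qed
    then have feas: "\<sigma> + t *\<^sub>R X \<in> feasible_pd k H c"
      using \<sigma> X by (auto simp: feasible_pd_def feasible_set_def density_ops_def
          constraint_tangents_def trace_add trace_scaleR hs_inner_linear pos_def_imp_pos_semidef)
    then have "\<sigma> + t *\<^sub>R X \<in> herm_between 0 1"
      using density_ops_subset_herm_between by (auto simp: feasible_pd_def feasible_set_def)
    then have "\<sigma> + t *\<^sub>R X \<in> herm_between (\<epsilon> / 2) 1"
      using lower by (simp add: herm_between_def)
    then show ?thesis
      using feas by blast
  qed
  then show thesis
    using that[of "\<epsilon> / (2 * K)" "\<epsilon> / 2"] \<epsilon>(1) K(1) by simp
qed

text \<open>For small \<open>t > 0\<close>, minimality and \<open>tilted_entropy_diff_le\<close>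
  bound \<open>t * ?g t\<close> below by 0. Dividing by \<open>t\<close> and letting
  \<open>t\<close> tend to 0, by continuity of \<open>op_log\<close>, gives one inequality; the
  tangent \<open>- X\<close> gives the other.\<close>

lemma tilted_entropy_minimizer_stationary:
  assumes \<sigma>: "\<sigma> \<in> feasible_pd k H c"
    and min: "\<And>\<rho>. \<rho> \<in> feasible_set k H c \<Longrightarrow> tilted_entropy A \<sigma> \<le> tilted_entropy A \<rho>"
    and X: "X \<in> constraint_tangents k H"
  shows "hs_inner X (op_log \<sigma> - A) = 0"
proof -
  have nonneg: "0 \<le> hs_inner X (op_log \<sigma> - A)" if X: "X \<in> constraint_tangents k H" for X
  proof -
    obtain \<delta> \<epsilon> where \<delta>: "\<delta> > 0" and \<epsilon>: "\<epsilon> > 0"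
      and feas: "\<And>t. 0 \<le> t \<Longrightarrow> t \<le> \<delta> \<Longrightarrow> \<sigma> + t *\<^sub>R X \<in> feasible_pd k H c \<inter> herm_between \<epsilon> 1"
      using feasible_perturbation[OF \<sigma> X] by blast
    let ?g = "\<lambda>t. hs_inner X (op_log (\<sigma> + t *\<^sub>R X) - A)"
    have "continuous_on (herm_between \<epsilon> 1) (op_log :: complex^'a^'a \<Rightarrow> _)"
      unfolding op_log_def using \<epsilon> by (intro continuous_on_fun_calc continuous_intros) auto
    then have "continuous_on {0..\<delta>} (\<lambda>t. op_log (\<sigma> + t *\<^sub>R X))"
      by (rule continuous_on_compose2) (use feas in \<open>auto intro!: continuous_intros\<close>)
    then have cont: "continuous_on (closure {0<..\<delta>}) ?g"
      using \<delta> by (auto intro!: continuous_on_hs_inner continuous_intros)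
    have pos: "0 \<le> ?g t" if t: "t \<in> {0<..\<delta>}" for t
    proof -
      have f: "\<sigma> + t *\<^sub>R X \<in> feasible_pd k H c"
        using feas t by auto
      have "0 \<le> tilted_entropy A (\<sigma> + t *\<^sub>R X) - tilted_entropy A \<sigma>"
        using min f by (simp add: feasible_pd_def)
      also have "\<dots> \<le> hs_inner (\<sigma> + t *\<^sub>R X - \<sigma>) (op_log (\<sigma> + t *\<^sub>R X) - A)"
        using \<sigma> f by (intro tilted_entropy_diff_le) (auto simp: feasible_pd_def feasible_set_def)
      also have "\<dots> = t * ?g t"
        by (simp add: hs_inner_scaleR_left)
      finally show ?thesis
        using t by (simp add: zero_le_mult_iff)
    qed
    have "0 \<in> closure {0<..\<delta>}"
      using \<delta> by simp
    from continuous_ge_on_closure[OF cont this pos] show ?thesis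
      by simp
  qed
  have "- X \<in> constraint_tangents k H"
    using X herm_scaleR[of X "-1"] hs_inner_scaleR_left[of "-1" X] trace_scaleR[of "-1" X]
    by (simp add: constraint_tangents_def)
  from nonneg[OF X] nonneg[OF this] show ?thesis
    using hs_inner_scaleR_left[of "-1" X] by simp
qed

section \<open>Minimisers selected by \<open>arg_min_on\<close>\<close>

lemma arg_min_on_is_arg_min:
  assumes "y \<in> S" "\<And>x. x \<in> S \<Longrightarrow> (f :: 'a \<Rightarrow> real) y \<le> f x"
  shows "arg_min_on f S \<in> S" "x \<in> S \<Longrightarrow> f (arg_min_on f S) \<le> f x"
proof -
  have "is_arg_min f (\<lambda>x. x \<in> S) y"
    using assms by (auto simp: is_arg_min_def not_less)
  then have "is_arg_min f (\<lambda>x. x \<in> S) (arg_min_on f S)"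
    unfolding arg_min_on_def arg_min_def by (rule someI)
  then show "arg_min_on f S \<in> S" "x \<in> S \<Longrightarrow> f (arg_min_on f S) \<le> f x"
    by (auto simp: is_arg_min_def not_less)
qed

text \<open>Both functions yield the same predicate \<open>is_arg_min\<close>, so Hilbert choice
  picks the same element, whether or not the minimiser is unique. This absorbs additive constants
  and positive factors.\<close>

lemma arg_min_on_cong:
  assumes "\<And>x y. x \<in> S \<Longrightarrow> y \<in> S \<Longrightarrow> f x < f y \<longleftrightarrow> g x < g y"
  shows "arg_min_on f S = arg_min_on g S"
proof -
  have "is_arg_min f (\<lambda>x. x \<in> S) = is_arg_min g (\<lambda>x. x \<in> S)"
    using assms by (auto simp: is_arg_min_def fun_eq_iff)
  then show ?thesis
    by (simp add: arg_min_on_def arg_min_def)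
qed

text \<open>Compactness and continuity supply a minimiser, so the chosen point is one; the boundary
  slope makes it positive definite, and stationarity then applies.\<close>

lemma tilted_entropy_arg_min:
  fixes H :: "nat \<Rightarrow> complex^'n^'n" and A :: "complex^'n^'n"
  assumes "feasible_pd k H c \<noteq> {}"
  defines "\<sigma> \<equiv> arg_min_on (tilted_entropy A) (feasible_set k H c)"
  shows "\<sigma> \<in> feasible_pd k H c" and "X \<in> constraint_tangents k H \<Longrightarrow> hs_inner X (op_log \<sigma> - A) = 0"
proof -
  let ?M = "feasible_set k H c"
  obtain \<tau> where \<tau>: "\<tau> \<in> ?M" "pos_def \<tau>"
    using assms(1) by (auto simp: feasible_pd_def)
  have sub: "?M \<subseteq> density_ops"
    by (auto simp: feasible_set_def)
  have "continuous_on ?M (tilted_entropy A)"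
    by (rule continuous_on_subset[OF continuous_on_tilted_entropy sub])
  then obtain y where y: "y \<in> ?M" "\<And>x. x \<in> ?M \<Longrightarrow> tilted_entropy A y \<le> tilted_entropy A x"
    using continuous_attains_inf[OF compact_feasible_set, of k H c "tilted_entropy A"] \<tau>(1) by blast
  have \<sigma>M: "\<sigma> \<in> ?M" and min: "\<And>x. x \<in> ?M \<Longrightarrow> tilted_entropy A \<sigma> \<le> tilted_entropy A x"
    unfolding \<sigma>_def using arg_min_on_is_arg_min[of y ?M "tilted_entropy A", OF y] by blast+
  have "pos_def \<sigma>"
    using tilted_entropy_minimizer_pos_def[OF convex_feasible_set sub \<tau> \<sigma>M min] .
  then show "\<sigma> \<in> feasible_pd k H c"
    using \<sigma>M by (simp add: feasible_pd_def)
  then show "X \<in> constraint_tangents k H \<Longrightarrow> hs_inner X (op_log \<sigma> - A) = 0"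
    using tilted_entropy_minimizer_stationary min by blast
qed

section \<open>Both updates as minimisers of a tilted entropy\<close>

lemma op_log_gibbs_update:
  assumes "op_log \<rho> - (1 / \<gamma>) *\<^sub>R \<Omega> \<rho> \<in> herm"
  obtains a where "op_log (gibbs_update \<Omega> \<gamma> \<rho>) = op_log \<rho> - (1 / \<gamma>) *\<^sub>R \<Omega> \<rho> - a *\<^sub>R mat 1"
proof -
  define B where "B = op_log \<rho> - (1 / \<gamma>) *\<^sub>R \<Omega> \<rho>"
  obtain U d where U: "unitary_op U" and B: "B = U ** diag_op d ** adj U"
    using hermitian_diagonalization assms unfolding B_def by blast
  define Z where "Z = (\<Sum>i\<in>UNIV. exp (d i))"
  have Z: "Z > 0"
    unfolding Z_def by (intro sum_pos) auto
  have E: "op_exp B = U ** diag_op (\<lambda>i. exp (d i)) ** adj U"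
    unfolding op_exp_def B by (rule fun_calc_diag[OF U])
  have "Re (trace (op_exp B)) = Z"
    unfolding E hs_inner_mat_1[symmetric]
    by (simp add: hs_inner_diag_conj dot_square_norm unitary_norm_column[OF U] Z_def)
  then have "gibbs_update \<Omega> \<gamma> \<rho> = (1 / Z) *\<^sub>R (U ** diag_op (\<lambda>i. exp (d i)) ** adj U)"
    by (simp add: gibbs_update_def Let_def E flip: B_def)
  also have "\<dots> = U ** diag_op (\<lambda>i. 1 / Z * exp (d i)) ** adj U"
    by (simp only: diag_op_scaleR matrix_mult_add_scaleR)
  finally have "gibbs_update \<Omega> \<gamma> \<rho> = U ** diag_op (\<lambda>i. 1 / Z * exp (d i)) ** adj U" .
  then have "op_log (gibbs_update \<Omega> \<gamma> \<rho>) = U ** diag_op (\<lambda>i. ln (1 / Z * exp (d i))) ** adj U"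
    by (simp only: op_log_def fun_calc_diag[OF U])
  \<comment> \<open>The logarithm undoes the exponential, and normalisation by \<open>Z\<close>
    becomes a shift by \<open>ln Z\<close>.\<close>
  also have "(\<lambda>i. ln (1 / Z * exp (d i))) = (\<lambda>i. d i + - ln Z)"
    using Z by (simp add: ln_div fun_eq_iff)
  also have "U ** diag_op (\<lambda>i. d i + - ln Z) ** adj U = B + (- ln Z) *\<^sub>R (U ** mat 1 ** adj U)"
    unfolding diag_op_add diag_op_const matrix_mult_add_scaleR B ..
  also have "\<dots> = B - ln Z *\<^sub>R mat 1"
    using U by (simp add: unitary_op_def)
  finally show thesis
    using that unfolding B_def by blast
qed

lemma hs_inner_feasible_mat_1: "\<sigma> \<in> feasible_set k H c \<Longrightarrow> hs_inner \<sigma> (mat 1) = 1"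
  by (simp add: feasible_set_def density_ops_def hs_inner_mat_1)

text \<open>Normalising the Gibbs state shifts its logarithm by a multiple of the identity, which
  contributes only the constant \<open>a\<close> on states of trace 1.\<close>

lemma ab_map_eq_arg_min:
  assumes "op_log \<rho> - (1 / \<gamma>) *\<^sub>R \<Omega> \<rho> \<in> herm"
  shows "ab_map (feasible_set k H c) \<Omega> \<gamma> \<rho> =
     arg_min_on (tilted_entropy (op_log \<rho> - (1 / \<gamma>) *\<^sub>R \<Omega> \<rho>)) (feasible_set k H c)"
proof -
  obtain a where "op_log (gibbs_update \<Omega> \<gamma> \<rho>) = op_log \<rho> - (1 / \<gamma>) *\<^sub>R \<Omega> \<rho> - a *\<^sub>R mat 1"
    using op_log_gibbs_update[of \<rho> \<gamma> \<Omega>, OF assms] by blast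
  then have "rel_entropy \<sigma> (gibbs_update \<Omega> \<gamma> \<rho>) =
      tilted_entropy (op_log \<rho> - (1 / \<gamma>) *\<^sub>R \<Omega> \<rho>) \<sigma> + a" if "\<sigma> \<in> feasible_set k H c" for \<sigma>
    using that by (simp add: rel_entropy_eq_tilted_entropy tilted_entropy_def hs_inner_linear
        hs_inner_feasible_mat_1)
  then show ?thesis
    unfolding ab_map_def by (intro arg_min_on_cong) simp
qed

lemma md_map_eq_arg_min:
  assumes "\<gamma> > 0"
  shows "md_map M G \<gamma> \<rho> = arg_min_on (tilted_entropy (op_log \<rho> - (1 / \<gamma>) *\<^sub>R G \<rho>)) M"
proof -
  have "hs_inner \<sigma> (G \<rho>) + \<gamma> * rel_entropy \<sigma> \<rho> =
      \<gamma> * tilted_entropy (op_log \<rho> - (1 / \<gamma>) *\<^sub>R G \<rho>) \<sigma>" for \<sigma>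
    using assms by (simp add: rel_entropy_eq_tilted_entropy tilted_entropy_def hs_inner_linear field_simps)
  then show ?thesis
    unfolding md_map_def using assms by (intro arg_min_on_cong) simp
qed

section \<open>Comparison of single steps and of orbits\<close>

lemma feasible_diff_tangent:
  assumes "\<sigma> \<in> feasible_set k H c" "\<tau> \<in> feasible_set k H c"
  shows "\<sigma> - \<tau> \<in> constraint_tangents k H"
  using assms
  by (simp add: feasible_set_def constraint_tangents_def density_ops_def pos_semidef_def herm_diff
      trace_sub hs_inner_linear)

lemma ab_md_step:
  fixes H :: "nat \<Rightarrow> complex^'n^'n"
  assumes ne: "feasible_pd k H c \<noteq> {}" and \<gamma>: "\<gamma> > 0"
    and \<rho>: "\<rho> \<in> herm" "\<Omega> \<rho> \<in> herm" "G \<rho> \<in> herm"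
  shows "ab_map (feasible_set k H c) \<Omega> \<gamma> \<rho> \<in> feasible_pd k H c"
    and "ab_map (feasible_set k H c) \<Omega> \<gamma> \<rho> = md_map (feasible_set k H c) G \<gamma> \<rho> \<longleftrightarrow>
         \<Omega> \<rho> - G \<rho> \<in> constraint_normals k H"
proof -
  let ?M = "feasible_set k H c"
  define A where "A = op_log \<rho> - (1 / \<gamma>) *\<^sub>R \<Omega> \<rho>"
  define B where "B = op_log \<rho> - (1 / \<gamma>) *\<^sub>R G \<rho>"
  have "A \<in> herm"
    unfolding A_def op_log_def using \<rho> by (intro herm_diff herm_scaleR fun_calc_herm)
  then have ab: "ab_map ?M \<Omega> \<gamma> \<rho> = arg_min_on (tilted_entropy A) ?M"
    unfolding A_def by (rule ab_map_eq_arg_min)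
  have md: "md_map ?M G \<gamma> \<rho> = arg_min_on (tilted_entropy B) ?M"
    unfolding B_def by (rule md_map_eq_arg_min[OF \<gamma>])
  show "ab_map ?M \<Omega> \<gamma> \<rho> \<in> feasible_pd k H c"
    unfolding ab by (rule tilted_entropy_arg_min(1)[OF ne])
  have BA: "hs_inner X (B - A) = hs_inner X (\<Omega> \<rho> - G \<rho>) / \<gamma>" for X
    by (simp add: A_def B_def hs_inner_linear diff_divide_distrib)
  show "ab_map ?M \<Omega> \<gamma> \<rho> = md_map ?M G \<gamma> \<rho> \<longleftrightarrow> \<Omega> \<rho> - G \<rho> \<in> constraint_normals k H"
  proof
    assume eq: "ab_map ?M \<Omega> \<gamma> \<rho> = md_map ?M G \<gamma> \<rho>"
    have "hs_inner X (\<Omega> \<rho> - G \<rho>) = 0" if X: "X \<in> constraint_tangents k H" for X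
    proof -
      \<comment> \<open>Both stationarity conditions hold at the same point, so subtracting them
        eliminates its logarithm.\<close>
      have "hs_inner X (B - A) = 0"
        using tilted_entropy_arg_min(2)[OF ne X, of A] tilted_entropy_arg_min(2)[OF ne X, of B]
          eq ab md by (simp add: hs_inner_diff_right)
      then show ?thesis
        using BA \<gamma> by simp
    qed
    then show "\<Omega> \<rho> - G \<rho> \<in> constraint_normals k H"
      using \<rho> by (simp add: constraint_normals_def herm_diff)
  next
    assume N: "\<Omega> \<rho> - G \<rho> \<in> constraint_normals k H"
    have "tilted_entropy A \<sigma> < tilted_entropy A \<tau> \<longleftrightarrow> tilted_entropy B \<sigma> < tilted_entropy B \<tau>"
      if "\<sigma> \<in> ?M" "\<tau> \<in> ?M" for \<sigma> \<tau>
    proof -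
      \<comment> \<open>Differences of feasible states are tangent, so replacing \<open>A\<close> by
        \<open>B\<close> leaves differences of the objective unchanged.\<close>
      have "hs_inner (\<sigma> - \<tau>) (B - A) = 0"
        using N feasible_diff_tangent[OF that] by (simp add: BA constraint_normals_def)
      then have "tilted_entropy A \<sigma> - tilted_entropy A \<tau> = tilted_entropy B \<sigma> - tilted_entropy B \<tau>"
        by (simp add: tilted_entropy_def hs_inner_linear)
      then show ?thesis
        by linarith
    qed
    then show "ab_map ?M \<Omega> \<gamma> \<rho> = md_map ?M G \<gamma> \<rho>"
      unfolding ab md by (intro arg_min_on_cong)
  qed
qed

theorem corollary5:
  fixes H :: "nat \<Rightarrow> complex^'n^'n" and c :: "nat \<Rightarrow> real" and k :: nat
    and \<Omega> G :: "complex^'n^'n \<Rightarrow> complex^'n^'n" and \<gamma> :: real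
  defines "M \<equiv> feasible_set k H c"
    and "Mpd \<equiv> feasible_pd k H c"
    and "N \<equiv> constraint_normals k H"
    and "AB \<equiv> ab_map (feasible_set k H c) \<Omega> \<gamma>"
    and "MD \<equiv> md_map (feasible_set k H c) G \<gamma>"
  assumes "\<And>j. j \<in> {1..k} \<Longrightarrow> H j \<in> herm"
    and "id_constraints_independent k H"
    and "Mpd \<noteq> {}"
    and "\<And>\<rho>. \<rho> \<in> density_ops \<Longrightarrow> \<Omega> \<rho> \<in> herm"
    and "continuous_on density_ops \<Omega>"
    and "\<gamma> > 0"
    and "\<And>\<rho>. \<rho> \<in> Mpd \<Longrightarrow> gradient_rel M (objective \<Omega>) \<rho> (G \<rho>)"
  shows "(\<forall>\<rho>0\<in>Mpd. \<forall>T\<ge>1.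
            (\<forall>t\<le>T. (AB ^^ t) \<rho>0 = (MD ^^ t) \<rho>0) \<longleftrightarrow>
            (\<forall>t<T. \<Omega> ((AB ^^ t) \<rho>0) - G ((AB ^^ t) \<rho>0) \<in> N))
       \<and> ((\<forall>\<rho>\<in>Mpd. AB \<rho> = MD \<rho>) \<longleftrightarrow> (\<forall>\<rho>\<in>Mpd. \<Omega> \<rho> - G \<rho> \<in> N))"
proof -
  have step: "AB \<rho> \<in> Mpd" "AB \<rho> = MD \<rho> \<longleftrightarrow> \<Omega> \<rho> - G \<rho> \<in> N" if "\<rho> \<in> Mpd" for \<rho>
  proof -
    have "G \<rho> \<in> herm"
      using assms(12)[OF that] by (simp add: gradient_rel_def)
    moreover have "\<rho> \<in> herm" "\<Omega> \<rho> \<in> herm"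
      using that assms(9) by (auto simp: Mpd_def feasible_pd_def feasible_set_def pos_def_def)
    ultimately show "AB \<rho> \<in> Mpd" "AB \<rho> = MD \<rho> \<longleftrightarrow> \<Omega> \<rho> - G \<rho> \<in> N"
      using ab_md_step[of k H c \<gamma> \<rho> \<Omega> G] assms(8,11) unfolding AB_def MD_def Mpd_def N_def by blast+
  qed
  have iterate: "(AB ^^ t) \<rho>0 \<in> Mpd" if "\<rho>0 \<in> Mpd" for t \<rho>0
    using that by (induction t) (auto simp: step)
  \<comment> \<open>Induction on \<open>T\<close>, starting from 0, where both sides hold trivially.
    If the orbits agree at \<open>T\<close>, both maps act on the same point of \<open>Mpd\<close>,
    so agreement at \<open>Suc T\<close> is exactly the one-step criterion there.\<close>
  have "(\<forall>t\<le>T. (AB ^^ t) \<rho>0 = (MD ^^ t) \<rho>0) \<longleftrightarrow>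
        (\<forall>t<T. \<Omega> ((AB ^^ t) \<rho>0) - G ((AB ^^ t) \<rho>0) \<in> N)" if \<rho>0: "\<rho>0 \<in> Mpd" for \<rho>0 T
  proof (induction T)
    case (Suc T)
    have "(AB ^^ Suc T) \<rho>0 = (MD ^^ Suc T) \<rho>0 \<longleftrightarrow> \<Omega> ((AB ^^ T) \<rho>0) - G ((AB ^^ T) \<rho>0) \<in> N"
      if "(AB ^^ T) \<rho>0 = (MD ^^ T) \<rho>0"
      using step(2)[OF iterate[OF \<rho>0, of T]] that by simp
    then show ?case
      using Suc.IH unfolding All_less_Suc less_Suc_eq_le[symmetric] by blast
  qed simp
  then show ?thesis
    using step by blast
qed

end
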